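(* Let $p\in(0,1)$, let $F_p$ be the stabilizer of $p$ in Thompson's group $F$, and let $\sigma$ be a finite-dimensional unitary representation of $F_p$. Then for all $s\in\mathbb{R}$ the representation $\mathrm{Ind}_{F_p}^F\sigma$ of $F$ is not equivalent to the unitary representation $\pi_s$ of $F$ on $L^2([0,1])$ given by $\pi_s(\gamma) f = \left(\frac{d\gamma_*\mu}{d\mu}\right)^{1/2+is} \, f\circ\gamma^{-1}$, where $\mu$ is the Lebesgue measure on $[0,1]$.
   Context: Thompson's group $F$ consists of all orientation-preserving piecewise linear homeomorphisms $\phi$ of the unit interval $[0,1]$ such that (1) $\phi$ preserves the set $\mathbb{Z}[1/2]\cap[0,1]$ of dyadic rationals in $[0,1]$; (2) $\phi$ has finitely many nondifferentiability points, all lying in $\mathbb{Z}[1/2]$; (3) the slopes of $\phi$ are of the form $2^k$, $k\in\mathbb{Z}$. $F$ is regarded as a discrete group. For $p\in(0,1)$, $F_p=\{\gamma\in F:\gamma(p)=p\}$. For a subgroup $H$ of a discrete group $G$ and a unitary representation $\sigma$ of $H$, $\mathrm{Ind}_H^G\sigma$ denotes the usual unitarily induced ($\ell^2$) representation of $G$. The Lebesgue measure $\mu$ on $[0,1]$ is quasi-invariant under $F$; $\gamma_*\mu$ is the pushforward of $\mu$ and $d\gamma_*\mu/d\mu$ its Radon–Nikodym derivative. $L^2([0,1])$ is the complex Hilbert space with respect to $\mu$. Equivalence means unitary equivalence. *)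

theory Defs
  imports
    "HOL-Analysis.Analysis"
    "HOL-Algebra.Bij"
    "HOL-Algebra.Left_Coset"
    "HOL-Algebra.Module"
    "HOL-Algebra.Algebraic_Closure_Type"
begin

section \<open>Complex Hilbert spaces and unitary representations\<close>

text \<open>
  Hilbert spaces are given by explicit carriers, since the space of an induced representation
  depends on the representation one induces from. The fields \<^term>\<open>monoid.mult\<close> and
  \<^term>\<open>monoid.one\<close>, which the module record inherits from the ring record, play no role.
  The inner product is linear in the first argument.
\<close>

record 'v complex_ip_space = "(complex, 'v) module" +
  cip :: "'v \<Rightarrow> 'v \<Rightarrow> complex"

locale complex_inner_product_space =
  module "ring_of_type_algebra :: complex ring" V
  for V :: "('v, 'x) complex_ip_space_scheme" (structure) +
  assumes cip_add_left:
      "\<lbrakk>x \<in> carrier V; y \<in> carrier V; z \<in> carrier V\<rbrakk>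
        \<Longrightarrow> cip V (x \<oplus> y) z = cip V x z + cip V y z"
    and cip_smult_left:
      "\<lbrakk>x \<in> carrier V; y \<in> carrier V\<rbrakk> \<Longrightarrow> cip V (a \<odot> x) y = a * cip V x y"
    and cip_cnj: "\<lbrakk>x \<in> carrier V; y \<in> carrier V\<rbrakk> \<Longrightarrow> cip V x y = cnj (cip V y x)"
    and cip_pos: "\<lbrakk>x \<in> carrier V; x \<noteq> \<zero>\<rbrakk> \<Longrightarrow> 0 < Re (cip V x x)"

definition cip_norm :: "('v, 'x) complex_ip_space_scheme \<Rightarrow> 'v \<Rightarrow> real" where
  "cip_norm V v = sqrt (Re (cip V v v))"

locale complex_hilbert_space = complex_inner_product_space +
  assumes complete: "Metric_space.mcomplete (carrier V) (\<lambda>x y. cip_norm V (x \<ominus> y))"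

definition finite_dimensional :: "('v, 'x) complex_ip_space_scheme \<Rightarrow> bool" where
  "finite_dimensional V \<longleftrightarrow>
    (\<exists>B. finite B \<and> B \<subseteq> carrier V \<and>
      (\<forall>v\<in>carrier V. \<exists>c. v = (\<Oplus>\<^bsub>V\<^esub>b\<in>B. c b \<odot>\<^bsub>V\<^esub> b)))"

definition unitary_map ::
  "('v, 'x) complex_ip_space_scheme \<Rightarrow> ('w, 'y) complex_ip_space_scheme \<Rightarrow> ('v \<Rightarrow> 'w) \<Rightarrow> bool" where
  "unitary_map V W U \<longleftrightarrow>
    bij_betw U (carrier V) (carrier W) \<and>
    (\<forall>x\<in>carrier V. \<forall>y\<in>carrier V. U (x \<oplus>\<^bsub>V\<^esub> y) = U x \<oplus>\<^bsub>W\<^esub> U y) \<and>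
    (\<forall>a. \<forall>x\<in>carrier V. U (a \<odot>\<^bsub>V\<^esub> x) = a \<odot>\<^bsub>W\<^esub> U x) \<and>
    (\<forall>x\<in>carrier V. \<forall>y\<in>carrier V. cip W (U x) (U y) = cip V x y)"

text \<open>Groups are discrete, so there is no continuity condition.\<close>

locale unitary_rep = G?: group G + V?: complex_hilbert_space V
  for G :: "('g, 'a) monoid_scheme" and V :: "('v, 'x) complex_ip_space_scheme"
    and \<rho> :: "'g \<Rightarrow> 'v \<Rightarrow> 'v" +
  assumes unitary: "g \<in> carrier G \<Longrightarrow> unitary_map V V (\<rho> g)"
    and rep_mult: "\<lbrakk>g \<in> carrier G; h \<in> carrier G; v \<in> carrier V\<rbrakk>
      \<Longrightarrow> \<rho> (g \<otimes>\<^bsub>G\<^esub> h) v = \<rho> g (\<rho> h v)"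

definition unitarily_equivalent ::
  "('g, 'a) monoid_scheme \<Rightarrow> ('v, 'x) complex_ip_space_scheme \<Rightarrow> ('g \<Rightarrow> 'v \<Rightarrow> 'v)
    \<Rightarrow> ('w, 'y) complex_ip_space_scheme \<Rightarrow> ('g \<Rightarrow> 'w \<Rightarrow> 'w) \<Rightarrow> bool" where
  "unitarily_equivalent G V \<rho> W \<tau> \<longleftrightarrow>
    (\<exists>U. unitary_map V W U \<and>
      (\<forall>g\<in>carrier G. \<forall>v\<in>carrier V. U (\<rho> g v) = \<tau> g (U v)))"


section \<open>Induced representations\<close>

text \<open>
  The space of \<open>Ind\<^sub>H\<^sup>G \<sigma>\<close> consists of the functions \<open>f : G \<rightarrow> V\<close> with
  \<open>f (g h) = \<sigma>(h)\<^sup>-\<^sup>1 f g\<close> for \<open>h \<in> H\<close> whose pointwise norm, which is constant on left cosets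
  of \<open>H\<close>, is square-summable over \<open>G/H\<close>; the group acts by left translation.
  Since \<open>\<sigma>\<close> is unitary, the summands below do not depend on the chosen coset representatives.
\<close>

definition coset_rep :: "'g set \<Rightarrow> 'g" where
  "coset_rep C = (SOME g. g \<in> C)"

definition ind_carrier ::
  "('g, 'a) monoid_scheme \<Rightarrow> 'g set \<Rightarrow> ('v, 'x) complex_ip_space_scheme \<Rightarrow> ('g \<Rightarrow> 'v \<Rightarrow> 'v)
    \<Rightarrow> ('g \<Rightarrow> 'v) set" where
  "ind_carrier G H V \<sigma> =
    {f \<in> carrier G \<rightarrow>\<^sub>E carrier V.
      (\<forall>g\<in>carrier G. \<forall>h\<in>H. f (g \<otimes>\<^bsub>G\<^esub> h) = \<sigma> (inv\<^bsub>G\<^esub> h) (f g)) \<and>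
      (\<lambda>C. (cip_norm V (f (coset_rep C)))\<^sup>2) summable_on (lcosets\<^bsub>G\<^esub> H)}"

definition ind_space ::
  "('g, 'a) monoid_scheme \<Rightarrow> 'g set \<Rightarrow> ('v, 'x) complex_ip_space_scheme \<Rightarrow> ('g \<Rightarrow> 'v \<Rightarrow> 'v)
    \<Rightarrow> ('g \<Rightarrow> 'v) complex_ip_space" where
  "ind_space G H V \<sigma> =
    \<lparr>carrier = ind_carrier G H V \<sigma>, monoid.mult = undefined, one = undefined,
     zero = (\<lambda>g\<in>carrier G. \<zero>\<^bsub>V\<^esub>),
     add = (\<lambda>f f'. \<lambda>g\<in>carrier G. f g \<oplus>\<^bsub>V\<^esub> f' g),
     smult = (\<lambda>a f. \<lambda>g\<in>carrier G. a \<odot>\<^bsub>V\<^esub> f g),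
     cip = (\<lambda>f f'. \<Sum>\<^sub>\<infinity>C\<in>lcosets\<^bsub>G\<^esub> H. cip V (f (coset_rep C)) (f' (coset_rep C)))\<rparr>"

definition ind_rep :: "('g, 'a) monoid_scheme \<Rightarrow> 'g \<Rightarrow> ('g \<Rightarrow> 'v) \<Rightarrow> 'g \<Rightarrow> 'v" where
  "ind_rep G g f = (\<lambda>x\<in>carrier G. f (inv\<^bsub>G\<^esub> g \<otimes>\<^bsub>G\<^esub> x))"


section \<open>The Hilbert space of square-integrable functions\<close>

definition square_integrable :: "'a measure \<Rightarrow> ('a \<Rightarrow> complex) \<Rightarrow> bool" where
  "square_integrable M f \<longleftrightarrow> f \<in> borel_measurable M \<and> integrable M (\<lambda>x. (cmod (f x))\<^sup>2)"

definition L2_class :: "'a measure \<Rightarrow> ('a \<Rightarrow> complex) \<Rightarrow> ('a \<Rightarrow> complex) set" where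
  "L2_class M f = {g. square_integrable M g \<and> (AE x in M. g x = f x)}"

definition L2_repr :: "('a \<Rightarrow> complex) set \<Rightarrow> 'a \<Rightarrow> complex" where
  "L2_repr A = (SOME f. f \<in> A)"

definition L2_space :: "'a measure \<Rightarrow> ('a \<Rightarrow> complex) set complex_ip_space" where
  "L2_space M =
    \<lparr>carrier = L2_class M ` {f. square_integrable M f},
     monoid.mult = undefined, one = undefined,
     zero = L2_class M (\<lambda>_. 0),
     add = (\<lambda>A B. L2_class M (\<lambda>x. L2_repr A x + L2_repr B x)),
     smult = (\<lambda>a A. L2_class M (\<lambda>x. a * L2_repr A x)),
     cip = (\<lambda>A B. \<integral>x. L2_repr A x * cnj (L2_repr B x) \<partial>M)\<rparr>"


section \<open>Thompson's group F\<close>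

definition dyadic_rationals :: "real set" where
  "dyadic_rationals = {of_int m / 2 ^ n | (m :: int) (n :: nat). True}"

definition nondiff_points :: "(real \<Rightarrow> real) \<Rightarrow> real set" where
  "nondiff_points \<phi> = {x \<in> {0..1}. \<not> \<phi> differentiable (at x within {0..1})}"

definition affine_with_slope :: "(real \<Rightarrow> real) \<Rightarrow> real \<Rightarrow> real \<Rightarrow> real \<Rightarrow> bool" where
  "affine_with_slope \<phi> m a b \<longleftrightarrow> (\<exists>c. \<forall>x\<in>{a..b}. \<phi> x = m * x + c)"

definition piecewise_linear :: "(real \<Rightarrow> real) \<Rightarrow> bool" where
  "piecewise_linear \<phi> \<longleftrightarrow>
    (\<exists>T. finite T \<and>
      (\<forall>a b. 0 \<le> a \<and> a < b \<and> b \<le> 1 \<and> {a<..<b} \<inter> T = {} \<longrightarrow> (\<exists>m. affine_with_slope \<phi> m a b)))"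

text \<open>
  Maps of \<open>[0,1]\<close> are represented by functions that are \<^const>\<open>undefined\<close> outside \<open>[0,1]\<close>,
  as in \<^const>\<open>BijGroup\<close>, whose product \<open>g \<otimes> f\<close> is the composition \<open>g \<circ> f\<close>.
\<close>

definition thompson_maps :: "(real \<Rightarrow> real) set" where
  "thompson_maps =
    {\<phi> \<in> extensional {0..1}.
      (\<exists>\<psi>. homeomorphism {0..1} {0..1} \<phi> \<psi>) \<and>
      strict_mono_on {0..1} \<phi> \<and>
      piecewise_linear \<phi> \<and>
      \<phi> ` (dyadic_rationals \<inter> {0..1}) = dyadic_rationals \<inter> {0..1} \<and>
      finite (nondiff_points \<phi>) \<and> nondiff_points \<phi> \<subseteq> dyadic_rationals \<and>
      (\<forall>a b m. 0 \<le> a \<and> a < b \<and> b \<le> 1 \<and> affine_with_slope \<phi> m a b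
        \<longrightarrow> (\<exists>k::int. m = 2 powi k))}"

definition thompson_F :: "(real \<Rightarrow> real) monoid" where
  "thompson_F = BijGroup {0..1} \<lparr>carrier := thompson_maps\<rparr>"

definition thompson_stabilizer :: "real \<Rightarrow> (real \<Rightarrow> real) set" where
  "thompson_stabilizer p = {\<gamma> \<in> carrier thompson_F. \<gamma> p = p}"


section \<open>The representations of F on square-integrable functions\<close>

text \<open>Borel instead of Lebesgue measurable functions give the same Hilbert space of a.e.-classes.\<close>

definition unit_lebesgue :: "real measure" where
  "unit_lebesgue = restrict_space lborel {0..1}"

definition principal_rep ::
  "real \<Rightarrow> (real \<Rightarrow> real) \<Rightarrow> (real \<Rightarrow> complex) set \<Rightarrow> (real \<Rightarrow> complex) set" where
  "principal_rep s \<gamma> A =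
    L2_class unit_lebesgue
      (\<lambda>x. complex_of_real (enn2real (RN_deriv unit_lebesgue (distr unit_lebesgue unit_lebesgue \<gamma>) x))
              powr (1 / 2 + \<i> * complex_of_real s)
            * L2_repr A ((inv\<^bsub>thompson_F\<^esub> \<gamma>) x))"

end

theory Submission
  imports Defs
begin

text \<open>
  Restricted to \<open>F\<^sub>p\<close>, the induced representation contains \<open>\<sigma>\<close>, realised on the functions supported
  on the trivial coset. In the finite-dimensional representation \<open>\<sigma>\<close> every vector is recurrent: for
  \<open>\<gamma> \<in> F\<^sub>p\<close> the vectors \<open>\<sigma>(\<gamma>\<^sup>n) v\<close> come back arbitrarily close to \<open>v\<close> for arbitrarily large \<open>n\<close>.
  If \<open>f \<in> L\<^sup>2([0,1])\<close> corresponds to such a \<open>v\<close>, then for every \<open>\<gamma> \<in> F\<^sub>p\<close> with \<open>\<gamma> x \<ge> x\<close> the mass of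
  \<open>\<pi>\<^sub>s(\<gamma>\<^sup>n) f\<close> on a wandering interval \<open>[c, \<gamma> c)\<close> is the mass of \<open>f\<close> on its preimage under \<open>\<gamma>\<^sup>n\<close>; these
  preimages are pairwise disjoint, so the masses tend to \<open>0\<close> and recurrence forces \<open>f = 0\<close> on
  \<open>[c, \<gamma> c)\<close>. Rescaled copies of a generator of \<open>F\<close> supported away from \<open>p\<close> provide countably many
  such intervals covering \<open>(0,1) - {p}\<close>, hence \<open>f = 0\<close> and \<open>v = 0\<close>.
\<close>

section \<open>Recurrence in finite-dimensional unitary representations\<close>

context complex_inner_product_space
begin

lemma smult_closed_complex [simp, intro]:
  "x \<in> carrier V \<Longrightarrow> a \<odot> x \<in> carrier V" for a :: complex
  using smult_closed[of a x] by (simp add: ring_of_type_algebra_def)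

lemma smult_minus_one: "x \<in> carrier V \<Longrightarrow> (- 1 :: complex) \<odot> x = \<ominus> x"
proof -
  assume x: "x \<in> carrier V"
  have *: "(0 :: complex) \<odot> x = \<zero>" "(1 :: complex) \<odot> x = x"
    using smult_l_null[OF x] smult_one[OF x] by (simp_all add: ring_of_type_algebra_def)
  have "(- 1 + 1 :: complex) \<odot> x = (- 1 :: complex) \<odot> x \<oplus> (1 :: complex) \<odot> x"
    using smult_l_distr[of "-1" 1 x] x by (simp add: ring_of_type_algebra_def)
  then show ?thesis
    using x * by (metis M.minus_equality add.left_inverse smult_closed_complex)
qed

lemma cip_zero_left [simp]: "y \<in> carrier V \<Longrightarrow> cip V \<zero> y = 0"
  using cip_add_left[of \<zero> \<zero> y] by simp

lemma cip_add_right: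
  "\<lbrakk>x \<in> carrier V; y \<in> carrier V; z \<in> carrier V\<rbrakk> \<Longrightarrow> cip V x (y \<oplus> z) = cip V x y + cip V x z"
  by (metis M.add.m_closed cip_add_left cip_cnj complex_cnj_add)

lemma cip_smult_right:
  "\<lbrakk>x \<in> carrier V; y \<in> carrier V\<rbrakk> \<Longrightarrow> cip V x (a \<odot> y) = cnj a * cip V x y"
  by (metis cip_cnj cip_smult_left complex_cnj_mult smult_closed_complex)

lemma cip_minus_left:
  assumes "x \<in> carrier V" "y \<in> carrier V" "z \<in> carrier V"
  shows "cip V (x \<ominus> y) z = cip V x z - cip V y z"
  using assms cip_smult_left[of y z "-1"]
  by (simp add: M.minus_eq smult_minus_one cip_add_left)

lemma cip_minus_right:
  assumes "x \<in> carrier V" "y \<in> carrier V" "z \<in> carrier V"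
  shows "cip V z (x \<ominus> y) = cip V z x - cip V z y"
  using assms cip_smult_right[of z y "-1"]
  by (simp add: M.minus_eq smult_minus_one cip_add_right)

lemma cip_self_nonneg: "x \<in> carrier V \<Longrightarrow> 0 \<le> Re (cip V x x)"
  by (metis cip_pos cip_zero_left less_eq_real_def zero_complex.simps(1))

text \<open>Expand \<open>0 \<le> |x - a u|^2\<close> to bound the cross terms. This is the
  quadratic substitute for the triangle inequality, with no square roots. It keeps a sequence
  bounded after a coordinate is removed and carries Cauchy estimates back once the coordinate is
  restored.\<close>

lemma Re_cip_self_add_smult:
  assumes "x \<in> carrier V" "u \<in> carrier V"
  shows "Re (cip V (x \<oplus> a \<odot> u) (x \<oplus> a \<odot> u)) \<le> 2 * Re (cip V x x) + 2 * (cmod a)\<^sup>2 * Re (cip V u u)"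
proof -
  let ?au = "a \<odot> u"
  have au: "cip V ?au ?au = (cmod a)\<^sup>2 * cip V u u"
  proof -
    have "cip V ?au ?au = (a * cnj a) * cip V u u"
      using assms by (simp add: cip_smult_left cip_smult_right)
    then show ?thesis
      by (simp only: complex_norm_square)
  qed
  have "0 \<le> Re (cip V (x \<ominus> ?au) (x \<ominus> ?au))"
    using assms by (intro cip_self_nonneg) auto
  also have "\<dots> = Re (cip V x x) + Re (cip V ?au ?au) - Re (cip V x ?au) - Re (cip V ?au x)"
    using assms by (simp add: cip_minus_left cip_minus_right)
  finally have "Re (cip V x ?au) + Re (cip V ?au x) \<le> Re (cip V x x) + Re (cip V ?au ?au)"
    by simp
  moreover have "cip V (x \<oplus> ?au) (x \<oplus> ?au) = cip V x x + cip V ?au ?au + cip V x ?au + cip V ?au x"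
    using assms by (simp add: cip_add_left cip_add_right)
  ultimately have "Re (cip V (x \<oplus> ?au) (x \<oplus> ?au)) \<le> 2 * Re (cip V x x) + 2 * Re (cip V ?au ?au)"
    by simp
  then show ?thesis
    by (simp add: au)
qed

text \<open>Cauchy-Schwarz followed by the arithmetic-geometric mean inequality, obtained directly
  from the positivity of \<open>|x - \<zeta> u|^2\<close> for a suitable phase
  \<open>\<zeta>\<close>.\<close>

lemma cmod_cip_le:
  assumes "x \<in> carrier V" "u \<in> carrier V"
  shows "2 * cmod (cip V x u) \<le> Re (cip V x x) + Re (cip V u u)"
proof -
  \<comment> \<open>The phase of \<open>cip V x u\<close>: rotating \<open>u\<close> by it makes
    both cross terms equal to the real number \<open>cmod (cip V x u)\<close>.\<close>
  define \<zeta> where "\<zeta> = sgn (cip V x u)"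
  show ?thesis
  proof (cases "cip V x u = 0")
    case True
    then show ?thesis using assms cip_self_nonneg by simp
  next
    case False
    have z: "cnj \<zeta> * \<zeta> = 1"
      using False complex_norm_square[of \<zeta>] by (simp add: \<zeta>_def norm_sgn mult.commute)
    have c: "cip V x u = cmod (cip V x u) * \<zeta>"
      by (simp add: \<zeta>_def sgn_div_norm scaleR_conv_of_real False)
    have "cnj \<zeta> * cip V x u = cmod (cip V x u)"
      by (subst c) (simp add: z mult.left_commute)
    moreover have "\<zeta> * cip V u x = cnj (cnj \<zeta> * cip V x u)"
      using cip_cnj[OF assms(2,1)] by simp
    ultimately have *: "cnj \<zeta> * cip V x u = cmod (cip V x u)" "\<zeta> * cip V u x = cmod (cip V x u)"
      by simp_all
    have "0 \<le> Re (cip V (x \<ominus> \<zeta> \<odot> u) (x \<ominus> \<zeta> \<odot> u))"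
      using assms by (intro cip_self_nonneg) auto
    also have "cip V (x \<ominus> \<zeta> \<odot> u) (x \<ominus> \<zeta> \<odot> u) =
        cip V x x - cnj \<zeta> * cip V x u - \<zeta> * cip V u x + (cnj \<zeta> * \<zeta>) * cip V u u"
      using assms
      by (simp add: cip_minus_left cip_minus_right cip_smult_left cip_smult_right algebra_simps)
    finally show ?thesis
      by (simp add: * z)
  qed
qed

lemma bounded_range_cip:
  assumes x: "\<And>n :: nat. x n \<in> carrier V" and b: "b \<in> carrier V"
    and C: "\<And>n. Re (cip V (x n) (x n)) \<le> C"
  shows "bounded (range (\<lambda>n. cip V (x n) b))"
proof -
  have "cmod (cip V (x n) b) \<le> (C + Re (cip V b b)) / 2" for n
    using cmod_cip_le[OF x[of n] b] C[of n] by (simp add: field_simps)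
  then show ?thesis
    unfolding bounded_iff by blast
qed

lemma eq_zero_if_cip_self_eq_zero: "\<lbrakk>x \<in> carrier V; cip V x x = 0\<rbrakk> \<Longrightarrow> x = \<zero>"
  using cip_pos[of x] by force

text \<open>The difference is orthogonal to itself. Vector identities thereby reduce to identities
  between complex numbers, which \<open>algebra_simps\<close> can settle.\<close>

lemma cip_eqI:
  assumes "x \<in> carrier V" "y \<in> carrier V" "\<And>z. z \<in> carrier V \<Longrightarrow> cip V x z = cip V y z"
  shows "x = y"
proof -
  have "x \<ominus> y = \<zero>"
    using assms by (intro eq_zero_if_cip_self_eq_zero) (simp_all add: cip_minus_left)
  then have "\<ominus> (\<ominus> y) = x"
    using assms(1,2) by (intro M.minus_equality) (simp_all add: M.minus_eq)
  then show ?thesis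
    using assms(2) by simp
qed

lemma minus_self [simp]: "x \<in> carrier V \<Longrightarrow> x \<ominus> x = \<zero>"
  by (intro eq_zero_if_cip_self_eq_zero) (simp_all add: cip_minus_left)

text \<open>Induction on \<open>B\<close>: the first element of \<open>B\<close> that is not orthogonal to \<open>A\<^sup>\<bottom>\<close> splits off a
  bounded scalar coordinate, and what remains lies in a smaller orthogonal complement.\<close>

lemma Cauchy_subsequence_of_total:
  assumes "finite B" "B \<subseteq> carrier V" "A \<subseteq> carrier V"
    and total: "\<And>w. \<lbrakk>w \<in> carrier V; \<And>b. b \<in> A \<union> B \<Longrightarrow> cip V w b = 0\<rbrakk> \<Longrightarrow> w = \<zero>"
    and x: "\<And>n :: nat. x n \<in> carrier V" "\<And>n b. b \<in> A \<Longrightarrow> cip V (x n) b = 0"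
    and C: "\<And>n. Re (cip V (x n) (x n)) \<le> C"
  shows "\<exists>r. strict_mono (r :: nat \<Rightarrow> nat) \<and>
    (\<forall>\<epsilon>>0. \<exists>N. \<forall>m\<ge>N. \<forall>n\<ge>N. Re (cip V (x (r m) \<ominus> x (r n)) (x (r m) \<ominus> x (r n))) < \<epsilon>)"
  using assms
proof (induction B arbitrary: A x C rule: finite_induct)
  case empty
  then have "x n = \<zero>" for n
    by simp
  then have "x m \<ominus> x n = \<zero>" for m n
    by simp
  then show ?case
    by (intro exI[of _ id]) (auto simp: strict_mono_def)
next
  case (insert b B)
  from insert.prems have b: "b \<in> carrier V"
    by simp
  show ?case
  proof (cases "\<exists>u\<in>carrier V. (\<forall>a\<in>A. cip V u a = 0) \<and> cip V u b \<noteq> 0")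
    \<comment> \<open>Here \<open>b\<close> is orthogonal to the whole complement of
      \<open>A\<close>, so it moves into \<open>A\<close> and the sequence itself stays
      unchanged.\<close>
    case False
    then have "cip V (x n) b = 0" for n
      using insert.prems(4,5) by blast
    then show ?thesis
      using insert.prems by (intro insert.IH[of "insert b A" x C]) auto
  next
    case True
    then obtain u' where u': "u' \<in> carrier V" "\<And>a. a \<in> A \<Longrightarrow> cip V u' a = 0" "cip V u' b \<noteq> 0"
      by blast
    \<comment> \<open>Normalised so that pairing with \<open>b\<close> gives 1. Then
      \<open>c n\<close> is the coordinate of \<open>x n\<close> along \<open>u\<close>, and
      subtracting it makes \<open>y n\<close> orthogonal to \<open>b\<close> without losing
      orthogonality to \<open>A\<close>.\<close>
    define u where "u = (1 / cip V u' b) \<odot> u'"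
    have u: "u \<in> carrier V" "\<And>a. a \<in> A \<Longrightarrow> cip V u a = 0" "cip V u b = 1"
      using u' insert.prems(2) b by (auto simp: u_def cip_smult_left subset_iff)
    define c where "c n = cip V (x n) b" for n
    define y where "y n = x n \<oplus> (- c n) \<odot> u" for n
    have bdd: "bounded (range c)"
      unfolding c_def using insert.prems b by (intro bounded_range_cip) auto
    then obtain K where K: "cmod (c n) \<le> K" for n
      by (auto simp: bounded_iff)
    have "Re (cip V (y n) (y n)) \<le> 2 * C + 2 * K\<^sup>2 * Re (cip V u u)" for n
    proof -
      have "Re (cip V (y n) (y n)) \<le> 2 * Re (cip V (x n) (x n)) + 2 * (cmod (c n))\<^sup>2 * Re (cip V u u)"
        unfolding y_def using Re_cip_self_add_smult[OF insert.prems(4) u(1), of n "- c n"] by simp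
      moreover have "(cmod (c n))\<^sup>2 * Re (cip V u u) \<le> K\<^sup>2 * Re (cip V u u)"
        using K[of n] u cip_self_nonneg by (intro mult_right_mono power_mono) auto
      ultimately show ?thesis
        using insert.prems(6)[of n] by simp
    qed
    moreover have "cip V (y n) a = 0" if "a \<in> insert b A" for n a
      using that u b insert.prems by (auto simp: y_def cip_add_left cip_smult_left c_def subset_iff)
    moreover have "y n \<in> carrier V" for n
      using u insert.prems by (simp add: y_def)
    ultimately obtain r :: "nat \<Rightarrow> nat" where r: "strict_mono r"
      and yr: "\<And>\<epsilon>. \<epsilon> > 0 \<Longrightarrow>
        \<exists>N. \<forall>m\<ge>N. \<forall>n\<ge>N. Re (cip V (y (r m) \<ominus> y (r n)) (y (r m) \<ominus> y (r n))) < \<epsilon>"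
      using insert.IH[of "insert b A" y "2 * C + 2 * K\<^sup>2 * Re (cip V u u)"] insert.prems by auto
    have "bounded (range (c \<circ> r))"
      using bdd by (rule bounded_subset) auto
    then obtain l and r' :: "nat \<Rightarrow> nat" where r': "strict_mono r'" "(c \<circ> r \<circ> r') \<longlonglongrightarrow> l"
      using bounded_imp_convergent_subsequence[of "c \<circ> r"] by blast
    have "\<exists>N. \<forall>m\<ge>N. \<forall>n\<ge>N. Re (cip V (x (r (r' m)) \<ominus> x (r (r' n))) (x (r (r' m)) \<ominus> x (r (r' n)))) < \<epsilon>"
      if "\<epsilon> > 0" for \<epsilon>
    proof -
      \<comment> \<open>Chosen so that the \<open>y\<close> part and the \<open>u\<close> part each
        contribute at most \<open>\<epsilon> / 2\<close>. The \<open>+ 1\<close> makes the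
        denominator positive from \<open>0 \<le> Re (cip V u u)\<close> alone.\<close>
      define \<delta> where "\<delta> = sqrt (\<epsilon> / (4 * (Re (cip V u u) + 1)))"
      have uu: "0 \<le> Re (cip V u u)"
        using u by (simp add: cip_self_nonneg)
      then have \<delta>: "\<delta> > 0" "\<delta>\<^sup>2 * Re (cip V u u) \<le> \<epsilon> / 4"
        using that by (auto simp: \<delta>_def field_simps)
      from yr[of "\<epsilon> / 4"] that obtain N1 where N1:
        "\<And>m n. \<lbrakk>m \<ge> N1; n \<ge> N1\<rbrakk> \<Longrightarrow> Re (cip V (y (r m) \<ominus> y (r n)) (y (r m) \<ominus> y (r n))) < \<epsilon> / 4"
        by auto
      have "Cauchy (c \<circ> r \<circ> r')"
        using r'(2) by (rule LIMSEQ_imp_Cauchy)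
      from CauchyD[OF this \<delta>(1)] obtain N2 where N2:
        "\<And>m n. \<lbrakk>m \<ge> N2; n \<ge> N2\<rbrakk> \<Longrightarrow> cmod (c (r (r' m)) - c (r (r' n))) < \<delta>"
        by auto
      show ?thesis
      proof (intro exI allI impI)
        fix m n assume mn: "max N1 N2 \<le> m" "max N1 N2 \<le> n"
        define i where "i = r (r' m)"
        define j where "j = r (r' n)"
        have rr: "m \<le> r' m" "n \<le> r' n"
          using r'(1) by (simp_all add: seq_suble)
        let ?y = "y i \<ominus> y j" and ?d = "c i - c j"
        have yc: "y i \<in> carrier V" "y j \<in> carrier V"
          using u insert.prems by (simp_all add: y_def)
        have xc: "x i \<in> carrier V" "x j \<in> carrier V"
          using insert.prems by simp_all
        have "x i \<ominus> x j = ?y \<oplus> ?d \<odot> u"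
          using xc yc u
          by (intro cip_eqI)
            (simp_all add: cip_minus_left cip_add_left cip_smult_left y_def algebra_simps)
        then have "Re (cip V (x i \<ominus> x j) (x i \<ominus> x j)) \<le> 2 * Re (cip V ?y ?y) + 2 * ((cmod ?d)\<^sup>2 * Re (cip V u u))"
          using Re_cip_self_add_smult[of ?y u ?d] u yc by simp
        moreover have "Re (cip V ?y ?y) < \<epsilon> / 4"
          unfolding i_def j_def using N1[of "r' m" "r' n"] mn rr by simp
        moreover have "(cmod ?d)\<^sup>2 * Re (cip V u u) \<le> \<delta>\<^sup>2 * Re (cip V u u)"
          unfolding i_def j_def using N2[of m n] mn uu by (intro mult_right_mono power_mono) auto
        ultimately show "Re (cip V (x (r (r' m)) \<ominus> x (r (r' n))) (x (r (r' m)) \<ominus> x (r (r' n)))) < \<epsilon>"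
          using \<delta>(2) by (simp add: i_def j_def)
      qed
    qed
    then show ?thesis
      using strict_mono_o[OF r r'(1)] by (intro exI[of _ "r \<circ> r'"]) (auto simp: o_def)
  qed
qed

text \<open>By linearity \<open>w\<close> is orthogonal to itself. This turns a finite spanning set
  into the totality hypothesis of the subsequence lemma.\<close>

lemma eq_zero_of_orthogonal_finsum:
  assumes "finite B" "B \<subseteq> carrier V" "w \<in> carrier V" "\<And>b. b \<in> B \<Longrightarrow> cip V w b = 0"
    and w: "w = (\<Oplus>b\<in>B. c b \<odot> b)"
  shows "w = \<zero>"
proof -
  have "cip V w (\<Oplus>b\<in>B. c b \<odot> b) = 0"
    using assms(1,2,4)
  proof (induction B rule: finite_induct)
    case empty
    then show ?case
      using assms(3) by (metis cip_cnj cip_zero_left complex_cnj_zero M.finsum_empty M.zero_closed)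
  next
    case (insert b B)
    then have "(\<lambda>b. c b \<odot> b) \<in> B \<rightarrow> carrier V" "b \<in> carrier V"
      by auto
    then show ?case
      using insert assms(3) by (simp add: cip_add_right cip_smult_right M.finsum_closed)
  qed
  then show ?thesis
    using w assms(3) cip_pos[of w] by force
qed

lemma Cauchy_subsequence_finite_dimensional:
  assumes "finite_dimensional V"
    and x: "\<And>n :: nat. x n \<in> carrier V" and C: "\<And>n. Re (cip V (x n) (x n)) \<le> C"
  shows "\<exists>r. strict_mono (r :: nat \<Rightarrow> nat) \<and>
    (\<forall>\<epsilon>>0. \<exists>N. \<forall>m\<ge>N. \<forall>n\<ge>N. Re (cip V (x (r m) \<ominus> x (r n)) (x (r m) \<ominus> x (r n))) < \<epsilon>)"
proof -
  obtain B where B: "finite B" "B \<subseteq> carrier V"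
    and span: "\<And>v. v \<in> carrier V \<Longrightarrow> \<exists>c. v = (\<Oplus>b\<in>B. c b \<odot> b)"
    using assms(1) unfolding finite_dimensional_def by blast
  have "w = \<zero>" if "w \<in> carrier V" "\<And>b. b \<in> {} \<union> B \<Longrightarrow> cip V w b = 0" for w
    using eq_zero_of_orthogonal_finsum[OF B that(1)] span[OF that(1)] that(2) by blast
  then show ?thesis
    by (intro Cauchy_subsequence_of_total[OF B, of "{}" x C]) (use x C in auto)
qed

end

context unitary_rep
begin

lemma rep_closed: "\<lbrakk>g \<in> carrier G; v \<in> carrier V\<rbrakk> \<Longrightarrow> \<rho> g v \<in> carrier V"
  using unitary unfolding unitary_map_def by (meson bij_betwE)

lemma cip_rep:
  "\<lbrakk>g \<in> carrier G; v \<in> carrier V; w \<in> carrier V\<rbrakk> \<Longrightarrow> cip V (\<rho> g v) (\<rho> g w) = cip V v w"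
  using unitary unfolding unitary_map_def by blast

lemma rep_zero: "g \<in> carrier G \<Longrightarrow> \<rho> g \<zero>\<^bsub>V\<^esub> = \<zero>\<^bsub>V\<^esub>"
  using cip_rep[of g "\<zero>\<^bsub>V\<^esub>" "\<zero>\<^bsub>V\<^esub>"] cip_pos[of "\<rho> g \<zero>\<^bsub>V\<^esub>"] rep_closed[of g "\<zero>\<^bsub>V\<^esub>"] by force

text \<open>Two far apart terms of the orbit of \<open>v\<close> are close by compactness, and
  cancelling their common power of \<open>g\<close> by unitarity makes \<open>\<rho> (g^k) v\<close>
  close to \<open>v\<close>. Because both vectors have the same norm,
  \<open>|w - v|^2 = 2 |v|^2 - 2 Re (cip V w v)\<close>, so closeness is a lower bound on a real
  part.\<close>

lemma recurrence:
  assumes "finite_dimensional V" "g \<in> carrier G" "v \<in> carrier V" "\<epsilon> > 0"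
  shows "\<exists>n\<ge>m. Re (cip V (\<rho> (g [^]\<^bsub>G\<^esub> (n :: nat)) v) v) > Re (cip V v v) - \<epsilon>"
proof -
  define x where "x n = \<rho> (g [^]\<^bsub>G\<^esub> (n :: nat)) v" for n
  have x: "x n \<in> carrier V" "cip V (x n) (x n) = cip V v v" for n
    using assms by (simp_all add: x_def rep_closed cip_rep)
  from Cauchy_subsequence_finite_dimensional[OF assms(1), of x "Re (cip V v v)"] x
  obtain r :: "nat \<Rightarrow> nat" where r: "strict_mono r"
    and xr: "\<And>\<epsilon>. \<epsilon> > 0 \<Longrightarrow>
      \<exists>N. \<forall>m\<ge>N. \<forall>n\<ge>N. Re (cip V (x (r m) \<ominus>\<^bsub>V\<^esub> x (r n)) (x (r m) \<ominus>\<^bsub>V\<^esub> x (r n))) < \<epsilon>"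
    by auto
  obtain N where N: "\<And>m n. \<lbrakk>m \<ge> N; n \<ge> N\<rbrakk> \<Longrightarrow>
      Re (cip V (x (r m) \<ominus>\<^bsub>V\<^esub> x (r n)) (x (r m) \<ominus>\<^bsub>V\<^esub> x (r n))) < 2 * \<epsilon>"
    using xr[of "2 * \<epsilon>"] assms(4) by auto
  \<comment> \<open>The index \<open>r N + m + N\<close> is at least \<open>N\<close>, so the Cauchy
    estimate applies, and \<open>seq_suble\<close> places its image at least \<open>m\<close> beyond
    \<open>r N\<close>.\<close>
  define k where "k = r (r N + m + N) - r N"
  have "r N + m + N \<le> r (r N + m + N)"
    using r by (rule seq_suble)
  then have k: "r (r N + m + N) = r N + k" "m \<le> k"
    by (auto simp: k_def)
  let ?w = "\<rho> (g [^]\<^bsub>G\<^esub> k) v"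
  have w: "?w \<in> carrier V"
    using assms by (simp add: rep_closed)
  have "x (r N + k) = \<rho> (g [^]\<^bsub>G\<^esub> r N) ?w"
    using assms rep_mult[of "g [^]\<^bsub>G\<^esub> r N" "g [^]\<^bsub>G\<^esub> k" v] by (simp add: x_def G.nat_pow_mult)
  then have *: "cip V (x (r N + k)) (x (r N)) = cip V ?w v"
    using assms w by (simp add: x_def cip_rep)
  have "Re (cip V (x (r N + k) \<ominus>\<^bsub>V\<^esub> x (r N)) (x (r N + k) \<ominus>\<^bsub>V\<^esub> x (r N))) < 2 * \<epsilon>"
    using N[of "r N + m + N" N] k by simp
  also have "cip V (x (r N + k) \<ominus>\<^bsub>V\<^esub> x (r N)) (x (r N + k) \<ominus>\<^bsub>V\<^esub> x (r N)) =
      2 * cip V v v - cip V ?w v - cnj (cip V ?w v)"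
    using x cip_cnj[of "x (r N)" "x (r N + k)"] * by (simp add: cip_minus_left cip_minus_right)
  finally show ?thesis
    using k(2) by (intro exI[of _ k]) simp
qed

end

section \<open>The trivial coset in an induced representation\<close>

text \<open>The only equivariant function that vanishes off the trivial coset and takes the value
  \<open>v\<close> at the unit.\<close>

definition ind_embed ::
  "('g, 'a) monoid_scheme \<Rightarrow> 'g set \<Rightarrow> ('v, 'x) complex_ip_space_scheme \<Rightarrow> ('g \<Rightarrow> 'v \<Rightarrow> 'v)
    \<Rightarrow> 'v \<Rightarrow> 'g \<Rightarrow> 'v" where
  "ind_embed G H V \<sigma> v = (\<lambda>x\<in>carrier G. if x \<in> H then \<sigma> (inv\<^bsub>G\<^esub> x) v else \<zero>\<^bsub>V\<^esub>)"

lemma (in group) coset_rep_in_carrier: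
  assumes "subgroup H G" "C \<in> lcosets H"
  shows "coset_rep C \<in> carrier G"
proof -
  obtain a where a: "a \<in> carrier G" "C = a <# H"
    using assms(2) by (auto simp: LCOSETS_def)
  then have "coset_rep C \<in> C"
    unfolding coset_rep_def using lcos_self[OF a(1) assms(1)] by (metis someI)
  then show ?thesis
    using assms(1) a subgroup.elemlcos_carrier[OF assms(1)] group_axioms by blast
qed

text \<open>Cosets are disjoint, so a representative in \<open>H\<close> identifies the coset. Sums
  over all cosets of functions supported on \<open>H\<close> thus collapse to one term, whichever
  representative was chosen.\<close>

lemma (in group) coset_rep_in_subgroup_iff:
  assumes H: "subgroup H G" and "C \<in> lcosets H"
  shows "coset_rep C \<in> H \<longleftrightarrow> C = H"
proof -
  interpret H: subgroup H G
    by fact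
  obtain a where a: "a \<in> carrier G" "C = a <# H"
    using assms(2) by (auto simp: LCOSETS_def)
  have "coset_rep C \<in> C"
    unfolding coset_rep_def using a lcos_self[OF a(1) H] by (metis someI)
  then obtain h where h: "h \<in> H" "coset_rep C = a \<otimes> h"
    using a by (auto simp: l_coset_def)
  show ?thesis
  proof
    assume "coset_rep C \<in> H"
    then have "a \<otimes> h \<otimes> inv h \<in> H"
      using h by simp
    then have "a \<in> H"
      using a h by (simp add: m_assoc)
    then show "C = H"
      using a lcos_mult_one coset_join3[OF a(1) H] by simp
  next
    assume "C = H"
    then show "coset_rep C \<in> H"
      using \<open>coset_rep C \<in> C\<close> by simp
  qed
qed

lemma (in group) subgroup_in_lcosets: "subgroup H G \<Longrightarrow> H \<in> lcosets H"
  using coset_join3[of \<one> H] subgroup.one_closed by (fastforce simp: LCOSETS_def)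

context
  fixes G :: "('g, 'a) monoid_scheme" (structure) and H :: "'g set"
    and V :: "('v, 'x) complex_ip_space_scheme" and \<sigma> :: "'g \<Rightarrow> 'v \<Rightarrow> 'v"
  assumes group: "group G" and subgroup: "subgroup H G"
    and unitary_rep: "unitary_rep (G\<lparr>carrier := H\<rparr>) V \<sigma>"
begin

interpretation group G
  by (rule group)

interpretation H: subgroup H G
  by (rule subgroup)

interpretation \<sigma>: unitary_rep "G\<lparr>carrier := H\<rparr>" V \<sigma>
  by (rule unitary_rep)

lemma subgroup_rep_mult: "\<lbrakk>g \<in> H; h \<in> H; v \<in> carrier V\<rbrakk> \<Longrightarrow> \<sigma> (g \<otimes> h) v = \<sigma> g (\<sigma> h v)"
  using \<sigma>.rep_mult by simp

text \<open>Right translation by \<open>H\<close> preserves \<open>H\<close> and its complement. On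
  \<open>H\<close> equivariance is
  \<open>\<sigma> (inv (g h)) = \<sigma> (inv h) \<sigma> (inv g)\<close>, off \<open>H\<close> it
  says that \<open>\<sigma>\<close> fixes zero. Only one coset contributes to the square
  sum.\<close>

lemma ind_embed_closed:
  assumes v: "v \<in> carrier V"
  shows "ind_embed G H V \<sigma> v \<in> carrier (ind_space G H V \<sigma>)"
proof -
  let ?f = "ind_embed G H V \<sigma> v"
  have "?f \<in> carrier G \<rightarrow>\<^sub>E carrier V"
    using v \<sigma>.rep_closed by (auto simp: ind_embed_def)
  moreover have "?f (g \<otimes> h) = \<sigma> (inv h) (?f g)" if g: "g \<in> carrier G" and h: "h \<in> H" for g h
  proof -
    have "g \<otimes> h \<in> H \<longleftrightarrow> g \<in> H"
      using g h by (metis H.m_closed H.m_inv_closed H.mem_carrier inv_solve_right' m_closed)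
    then show ?thesis
      using g h v \<sigma>.rep_zero by (simp add: ind_embed_def inv_mult_group subgroup_rep_mult)
  qed
  moreover have "(\<lambda>C. (cip_norm V (?f (coset_rep C)))\<^sup>2) summable_on (lcosets H) \<longleftrightarrow>
      (\<lambda>C. (cip_norm V (?f (coset_rep C)))\<^sup>2) summable_on {H}"
    by (intro summable_on_cong_neutral)
      (use subgroup in \<open>auto simp: subgroup_in_lcosets ind_embed_def coset_rep_in_carrier
        coset_rep_in_subgroup_iff cip_norm_def\<close>)
  ultimately show ?thesis
    by (simp add: ind_space_def ind_carrier_def)
qed

text \<open>The trivial coset gives the only term, and unitarity of \<open>\<sigma>\<close> removes
  the unknown representative \<open>coset_rep H\<close> from it.\<close>

lemma cip_ind_embed:
  assumes v: "v \<in> carrier V" and w: "w \<in> carrier V"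
  shows "cip (ind_space G H V \<sigma>) (ind_embed G H V \<sigma> v) (ind_embed G H V \<sigma> w) = cip V v w"
proof -
  let ?c = "\<lambda>C. cip V (ind_embed G H V \<sigma> v (coset_rep C)) (ind_embed G H V \<sigma> w (coset_rep C))"
  have "coset_rep H \<in> H"
    using coset_rep_in_subgroup_iff[OF subgroup] subgroup_in_lcosets[OF subgroup] by blast
  then have "?c H = cip V v w"
    using v w \<sigma>.cip_rep by (simp add: ind_embed_def)
  moreover have "infsum ?c (lcosets H) = infsum ?c {H}"
    by (intro infsum_cong_neutral)
      (use subgroup in \<open>auto simp: subgroup_in_lcosets ind_embed_def coset_rep_in_carrier
        coset_rep_in_subgroup_iff\<close>)
  ultimately show ?thesis
    by (simp add: ind_space_def)
qed

text \<open>The embedding intertwines \<open>\<sigma>\<close> with the restriction of the induced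
  representation to \<open>H\<close>, because the inverse of \<open>inv h \<otimes> x\<close> is
  \<open>inv x \<otimes> h\<close>.\<close>

lemma ind_rep_ind_embed:
  assumes v: "v \<in> carrier V" and h: "h \<in> H"
  shows "ind_rep G h (ind_embed G H V \<sigma> v) = ind_embed G H V \<sigma> (\<sigma> h v)"
proof
  fix x
  show "ind_rep G h (ind_embed G H V \<sigma> v) x = ind_embed G H V \<sigma> (\<sigma> h v) x"
  proof (cases "x \<in> carrier G")
    case True
    have "inv h \<otimes> x \<in> H \<longleftrightarrow> x \<in> H"
      using True h by (metis H.m_closed H.m_inv_closed H.mem_carrier inv_solve_left m_closed)
    then show ?thesis
      using True h v by (simp add: ind_rep_def ind_embed_def inv_mult_group subgroup_rep_mult)
  qed (simp add: ind_rep_def ind_embed_def)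
qed

end

section \<open>The group structure of Thompson's group\<close>

lemma affine_with_slope_subset:
  "\<lbrakk>affine_with_slope \<phi> m a b; a \<le> a'; b' \<le> b\<rbrakk> \<Longrightarrow> affine_with_slope \<phi> m a' b'"
  unfolding affine_with_slope_def by (meson atLeastAtMost_iff order_trans)

lemma affine_with_slope_unique:
  assumes "affine_with_slope \<phi> m a b" "affine_with_slope \<phi> n a b" "a < b"
  shows "m = n"
proof -
  obtain c d where *: "\<And>x. x \<in> {a..b} \<Longrightarrow> \<phi> x = m * x + c" "\<And>x. x \<in> {a..b} \<Longrightarrow> \<phi> x = n * x + d"
    using assms unfolding affine_with_slope_def by blast
  have "m * a + c = n * a + d" "m * b + c = n * b + d"
    using *[of a] *[of b] assms(3) by simp_all
  then have "(m - n) * (b - a) = 0"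
    by (simp add: algebra_simps)
  then show ?thesis
    using assms(3) by simp
qed

text \<open>Take the nearest point of \<open>T\<close> to the right of \<open>u\<close>, capped at
  \<open>v\<close>.\<close>

lemma finite_avoid_right:
  fixes T :: "real set"
  assumes "finite T" "u < v"
  obtains w where "u < w" "w \<le> v" "{u<..<w} \<inter> T = {}"
proof
  let ?w = "Min (insert v (T \<inter> {u<..}))"
  show "u < ?w" "?w \<le> v" "{u<..<?w} \<inter> T = {}"
    using assms by auto
qed

lemma finite_avoid_left:
  fixes T :: "real set"
  assumes "finite T" "u < v"
  obtains w where "u \<le> w" "w < v" "{w<..<v} \<inter> T = {}"
proof
  let ?w = "Max (insert u (T \<inter> {..<v}))"
  show "u \<le> ?w" "?w < v" "{?w<..<v} \<inter> T = {}"
    using assms by auto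
qed

lemma piecewise_linear_right:
  assumes "piecewise_linear \<phi>" "0 \<le> u" "u < v" "v \<le> 1"
  obtains w m where "u < w" "w \<le> v" "affine_with_slope \<phi> m u w"
proof -
  obtain T where "finite T"
    and T: "\<And>a b. \<lbrakk>0 \<le> a; a < b; b \<le> 1; {a<..<b} \<inter> T = {}\<rbrakk> \<Longrightarrow> \<exists>m. affine_with_slope \<phi> m a b"
    using assms(1) unfolding piecewise_linear_def by blast
  obtain w where "u < w" "w \<le> v" "{u<..<w} \<inter> T = {}"
    using finite_avoid_right[OF \<open>finite T\<close> assms(3)] .
  then show ?thesis
    using that T[of u w] assms by auto
qed

lemma piecewise_linear_left:
  assumes "piecewise_linear \<phi>" "0 \<le> u" "u < v" "v \<le> 1"
  obtains w m where "u \<le> w" "w < v" "affine_with_slope \<phi> m w v"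
proof -
  obtain T where "finite T"
    and T: "\<And>a b. \<lbrakk>0 \<le> a; a < b; b \<le> 1; {a<..<b} \<inter> T = {}\<rbrakk> \<Longrightarrow> \<exists>m. affine_with_slope \<phi> m a b"
    using assms(1) unfolding piecewise_linear_def by blast
  obtain w where "u \<le> w" "w < v" "{w<..<v} \<inter> T = {}"
    using finite_avoid_left[OF \<open>finite T\<close> assms(3)] .
  then show ?thesis
    using that T[of w v] assms by auto
qed

section \<open>Closure of the Thompson maps under composition and inversion\<close>

lemma thompson_mapsD:
  assumes "\<phi> \<in> thompson_maps"
  shows "\<phi> \<in> extensional {0..1}" "strict_mono_on {0..1} \<phi>" "piecewise_linear \<phi>"
    "\<phi> ` (dyadic_rationals \<inter> {0..1}) = dyadic_rationals \<inter> {0..1}"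
    "finite (nondiff_points \<phi>)" "nondiff_points \<phi> \<subseteq> dyadic_rationals"
    "\<And>a b m. \<lbrakk>0 \<le> a; a < b; b \<le> 1; affine_with_slope \<phi> m a b\<rbrakk> \<Longrightarrow> \<exists>k::int. m = 2 powi k"
  using assms unfolding thompson_maps_def by auto

lemma thompson_maps_homeomorphism:
  assumes "\<phi> \<in> thompson_maps"
  obtains \<psi> where "homeomorphism {0..1} {0..1} \<phi> \<psi>"
  using assms unfolding thompson_maps_def by auto

lemma thompson_maps_bij_betw: "\<phi> \<in> thompson_maps \<Longrightarrow> bij_betw \<phi> {0..1} {0..1}"
  by (elim thompson_maps_homeomorphism, unfold homeomorphism_def, rule bij_betw_byWitness) auto

lemma thompson_maps_in_unit: "\<lbrakk>\<phi> \<in> thompson_maps; x \<in> {0..1}\<rbrakk> \<Longrightarrow> \<phi> x \<in> {0..1}"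
  using thompson_maps_bij_betw bij_betwE by blast

lemma thompson_maps_less_iff:
  "\<lbrakk>\<phi> \<in> thompson_maps; x \<in> {0..1}; y \<in> {0..1}\<rbrakk> \<Longrightarrow> \<phi> x < \<phi> y \<longleftrightarrow> x < y"
  by (rule strict_mono_on_less[OF thompson_mapsD(2)])

lemma thompson_maps_le_iff:
  "\<lbrakk>\<phi> \<in> thompson_maps; x \<in> {0..1}; y \<in> {0..1}\<rbrakk> \<Longrightarrow> \<phi> x \<le> \<phi> y \<longleftrightarrow> x \<le> y"
  by (metis not_le thompson_maps_less_iff)

lemma thompson_maps_dyadic_iff:
  assumes "\<phi> \<in> thompson_maps" "x \<in> {0..1}"
  shows "\<phi> x \<in> dyadic_rationals \<longleftrightarrow> x \<in> dyadic_rationals"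
proof
  assume "\<phi> x \<in> dyadic_rationals"
  then have "\<phi> x \<in> \<phi> ` (dyadic_rationals \<inter> {0..1})"
    using thompson_mapsD(4)[OF assms(1)] thompson_maps_in_unit[OF assms] by simp
  then show "x \<in> dyadic_rationals"
    using inj_onD[OF bij_betw_imp_inj_on[OF thompson_maps_bij_betw[OF assms(1)]]] assms(2) by fastforce
next
  assume "x \<in> dyadic_rationals"
  then show "\<phi> x \<in> dyadic_rationals"
    using thompson_mapsD(4)[OF assms(1)] assms(2) by blast
qed

text \<open>Break points of the composite are those of \<open>\<psi>\<close> and the
  \<open>\<psi>\<close>-preimages of those of \<open>\<phi>\<close>; the chain rule locates the
  nondifferentiable points in the same way, and slopes multiply.\<close>

lemma compose_in_thompson_maps:
  assumes \<phi>: "\<phi> \<in> thompson_maps" and \<psi>: "\<psi> \<in> thompson_maps"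
  shows "compose {0..1} \<phi> \<psi> \<in> thompson_maps"
proof -
  let ?I = "{0..1 :: real}"
  let ?\<chi> = "compose ?I \<phi> \<psi>"
  have \<chi>: "?\<chi> x = \<phi> (\<psi> x)" if "x \<in> ?I" for x
    using that by (simp add: compose_eq)
  have finite_preimage: "finite {x \<in> ?I. \<psi> x \<in> T}" if "finite T" for T
  proof -
    have "finite (\<psi> -` T \<inter> ?I)"
      using thompson_maps_bij_betw[OF \<psi>] that by (intro finite_vimage_IntI) (auto simp: bij_betw_def)
    then show ?thesis
      by (rule rev_finite_subset) auto
  qed
  have "?\<chi> \<in> extensional ?I"
    by (rule compose_extensional)
  moreover have "\<exists>\<chi>'. homeomorphism ?I ?I ?\<chi> \<chi>'"
  proof -
    obtain \<phi>' \<psi>' where "homeomorphism ?I ?I \<phi> \<phi>'" "homeomorphism ?I ?I \<psi> \<psi>'"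
      using thompson_maps_homeomorphism[OF \<phi>] thompson_maps_homeomorphism[OF \<psi>] by metis
    then have "homeomorphism ?I ?I (\<phi> \<circ> \<psi>) (\<psi>' \<circ> \<phi>')"
      by (intro homeomorphism_compose)
    then have "homeomorphism ?I ?I ?\<chi> (\<psi>' \<circ> \<phi>')"
      by (rule homeomorphism_cong) (auto simp: \<chi>)
    then show ?thesis
      by blast
  qed
  moreover have "strict_mono_on ?I ?\<chi>"
    by (intro strict_mono_onI)
      (metis \<chi> thompson_maps_less_iff[OF \<phi>] thompson_maps_less_iff[OF \<psi>] thompson_maps_in_unit[OF \<psi>])
  moreover have "piecewise_linear ?\<chi>"
  proof -
    obtain T where T: "finite T"
      "\<And>a b. \<lbrakk>0 \<le> a; a < b; b \<le> 1; {a<..<b} \<inter> T = {}\<rbrakk> \<Longrightarrow> \<exists>m. affine_with_slope \<phi> m a b"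
      using thompson_mapsD(3)[OF \<phi>] unfolding piecewise_linear_def by blast
    obtain T' where T': "finite T'"
      "\<And>a b. \<lbrakk>0 \<le> a; a < b; b \<le> 1; {a<..<b} \<inter> T' = {}\<rbrakk> \<Longrightarrow> \<exists>m. affine_with_slope \<psi> m a b"
      using thompson_mapsD(3)[OF \<psi>] unfolding piecewise_linear_def by blast
    have "\<exists>m. affine_with_slope ?\<chi> m a b"
      if ab: "0 \<le> a" "a < b" "b \<le> 1" and disj: "{a<..<b} \<inter> (T' \<union> {x \<in> ?I. \<psi> x \<in> T}) = {}" for a b
    proof -
      have abI: "a \<in> ?I" "b \<in> ?I"
        using ab by auto
      obtain m where "affine_with_slope \<psi> m a b"
        using T'(2)[OF ab] disj by blast
      then obtain c where m: "\<And>x. x \<in> {a..b} \<Longrightarrow> \<psi> x = m * x + c"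
        unfolding affine_with_slope_def by blast
      \<comment> \<open>A break point of \<open>\<phi>\<close> inside the image interval would have
        a preimage strictly between \<open>a\<close> and \<open>b\<close>, which the choice of the
        excluded set forbids.\<close>
      have "{\<psi> a<..<\<psi> b} \<inter> T = {}"
      proof (rule ccontr)
        assume "{\<psi> a<..<\<psi> b} \<inter> T \<noteq> {}"
        then obtain t where t: "t \<in> T" "\<psi> a < t" "t < \<psi> b"
          by auto
        then have "t \<in> ?I"
          using thompson_maps_in_unit[OF \<psi> abI(1)] thompson_maps_in_unit[OF \<psi> abI(2)] by auto
        then obtain x where x: "x \<in> ?I" "t = \<psi> x"
          using bij_betw_imp_surj_on[OF thompson_maps_bij_betw[OF \<psi>]] by blast
        then have "a < x" "x < b"
          using t thompson_maps_less_iff[OF \<psi>] abI by auto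
        then show False
          using disj x t by auto
      qed
      moreover have "\<psi> a < \<psi> b"
        using thompson_maps_less_iff[OF \<psi> abI] ab by simp
      ultimately obtain n where "affine_with_slope \<phi> n (\<psi> a) (\<psi> b)"
        using T(2)[of "\<psi> a" "\<psi> b"] thompson_maps_in_unit[OF \<psi> abI(1)] thompson_maps_in_unit[OF \<psi> abI(2)] by auto
      then obtain d where n: "\<And>y. y \<in> {\<psi> a..\<psi> b} \<Longrightarrow> \<phi> y = n * y + d"
        unfolding affine_with_slope_def by blast
      have "?\<chi> x = (n * m) * x + (n * c + d)" if x: "x \<in> {a..b}" for x
      proof -
        have "x \<in> ?I"
          using x ab by auto
        then have "\<psi> x \<in> {\<psi> a..\<psi> b}" "?\<chi> x = \<phi> (\<psi> x)"
          using thompson_maps_le_iff[OF \<psi>] x abI by (auto simp: \<chi>)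
        then show ?thesis
          using m[OF x] n[of "\<psi> x"] by (simp add: algebra_simps)
      qed
      then show ?thesis
        unfolding affine_with_slope_def by blast
    qed
    moreover have "finite (T' \<union> {x \<in> ?I. \<psi> x \<in> T})"
      using T(1) T'(1) finite_preimage by simp
    ultimately show ?thesis
      unfolding piecewise_linear_def
      by (intro exI[of _ "T' \<union> {x \<in> ?I. \<psi> x \<in> T}"]) simp
  qed
  moreover have "?\<chi> ` (dyadic_rationals \<inter> ?I) = dyadic_rationals \<inter> ?I"
  proof -
    have "?\<chi> ` (dyadic_rationals \<inter> ?I) = \<phi> ` \<psi> ` (dyadic_rationals \<inter> ?I)"
      unfolding image_image by (intro image_cong) (auto simp: \<chi>)
    then show ?thesis
      by (simp only: thompson_mapsD(4)[OF \<phi>] thompson_mapsD(4)[OF \<psi>])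
  qed
  moreover have nondiff: "nondiff_points ?\<chi> \<subseteq> nondiff_points \<psi> \<union> {x \<in> ?I. \<psi> x \<in> nondiff_points \<phi>}"
  proof
    fix x assume "x \<in> nondiff_points ?\<chi>"
    then have x: "x \<in> ?I" "\<not> ?\<chi> differentiable (at x within ?I)"
      by (auto simp: nondiff_points_def)
    show "x \<in> nondiff_points \<psi> \<union> {x \<in> ?I. \<psi> x \<in> nondiff_points \<phi>}"
    proof (rule ccontr)
      assume "\<not> ?thesis"
      then have "\<psi> differentiable (at x within ?I)" "\<phi> differentiable (at (\<psi> x) within \<psi> ` ?I)"
        using x(1) thompson_maps_in_unit[OF \<psi> x(1)] bij_betw_imp_surj_on[OF thompson_maps_bij_betw[OF \<psi>]]
        by (auto simp: nondiff_points_def)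
      then have "(\<phi> \<circ> \<psi>) differentiable (at x within ?I)"
        by (rule differentiable_chain_within)
      then have "?\<chi> differentiable (at x within ?I)"
        by (rule differentiable_transform_within[OF _ zero_less_one x(1)]) (simp add: \<chi>)
      then show False
        using x(2) by simp
    qed
  qed
  moreover have "finite (nondiff_points ?\<chi>)"
    using nondiff finite_preimage thompson_mapsD(5)[OF \<phi>] thompson_mapsD(5)[OF \<psi>]
    by (auto intro: finite_subset)
  moreover have "nondiff_points ?\<chi> \<subseteq> dyadic_rationals"
    using nondiff thompson_mapsD(6)[OF \<phi>] thompson_mapsD(6)[OF \<psi>] thompson_maps_dyadic_iff[OF \<psi>] by blast
  moreover have "\<exists>k::int. m = 2 powi k"
    if ab: "0 \<le> a" "a < b" "b \<le> 1" and m: "affine_with_slope ?\<chi> m a b" for a b m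
  proof -
    \<comment> \<open>The composite may be affine on \<open>[a, b]\<close> although its factors
      break there. Shrinking to a short interval \<open>[a, e]\<close> on which both factors are
      affine determines the slope.\<close>
    obtain b' m' where b': "a < b'" "b' \<le> b" "affine_with_slope \<psi> m' a b'"
      using piecewise_linear_right[OF thompson_mapsD(3)[OF \<psi>] ab] .
    have I: "a \<in> ?I" "b' \<in> ?I"
      using ab b' by auto
    have "0 \<le> \<psi> a" "\<psi> a < \<psi> b'" "\<psi> b' \<le> 1"
      using thompson_maps_in_unit[OF \<psi> I(1)] thompson_maps_in_unit[OF \<psi> I(2)] thompson_maps_less_iff[OF \<psi> I] b'
      by auto
    then obtain y n where y: "\<psi> a < y" "y \<le> \<psi> b'" "affine_with_slope \<phi> n (\<psi> a) y"
      using piecewise_linear_right[OF thompson_mapsD(3)[OF \<phi>]] by metis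
    have yI: "y \<in> ?I"
      using y thompson_maps_in_unit[OF \<psi> I(1)] thompson_maps_in_unit[OF \<psi> I(2)] by auto
    then obtain e where e: "e \<in> ?I" "y = \<psi> e"
      using bij_betw_imp_surj_on[OF thompson_maps_bij_betw[OF \<psi>]] by blast
    have ae: "a < e" "e \<le> b'"
      using y e I thompson_maps_less_iff[OF \<psi>] thompson_maps_le_iff[OF \<psi>] by auto
    obtain k l :: int where k: "m' = 2 powi k" and l: "n = 2 powi l"
      using thompson_mapsD(7)[OF \<psi> ab(1) b'(1) _ b'(3)] thompson_mapsD(7)[OF \<phi> _ y(1) _ y(3)]
        b' ab yI thompson_maps_in_unit[OF \<psi> I(1)] by auto
    obtain c where c: "\<And>x. x \<in> {a..b'} \<Longrightarrow> \<psi> x = m' * x + c"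
      using b'(3) unfolding affine_with_slope_def by blast
    obtain d where d: "\<And>x. x \<in> {\<psi> a..y} \<Longrightarrow> \<phi> x = n * x + d"
      using y(3) unfolding affine_with_slope_def by blast
    have "?\<chi> x = (n * m') * x + (n * c + d)" if x: "x \<in> {a..e}" for x
    proof -
      have "x \<in> ?I" "x \<in> {a..b'}"
        using x e ab ae by auto
      then have "\<psi> x \<in> {\<psi> a..y}" "?\<chi> x = \<phi> (\<psi> x)"
        using thompson_maps_le_iff[OF \<psi>] x I e by (auto simp: \<chi>)
      then show ?thesis
        using c[OF \<open>x \<in> {a..b'}\<close>] d[of "\<psi> x"] by (simp add: algebra_simps)
    qed
    then have "affine_with_slope ?\<chi> (n * m') a e"
      unfolding affine_with_slope_def by blast
    moreover have "affine_with_slope ?\<chi> m a e"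
      using affine_with_slope_subset[OF m] ae b' by simp
    ultimately have "m = n * m'"
      using affine_with_slope_unique ae by blast
    then have "m = 2 powi (l + k)"
      by (simp add: k l power_int_add)
    then show ?thesis
      by blast
  qed
  ultimately show ?thesis
    unfolding thompson_maps_def by blast
qed

text \<open>On an affine piece with endpoint \<open>x\<close> the derivative is the slope of the
  piece, a power of 2. This is what the inverse function rule requires.\<close>

lemma thompson_maps_derivative_nonzero:
  assumes \<phi>: "\<phi> \<in> thompson_maps" and x: "x \<in> {0..1}"
    and D: "(\<phi> has_field_derivative D) (at x within {0..1})"
  shows "D \<noteq> 0"
proof -
  obtain a b m where ab: "0 \<le> a" "a < b" "b \<le> 1" "x \<in> {a..b}" and m: "affine_with_slope \<phi> m a b"
  \<comment> \<open>At the endpoint 1 only a piece to the left is available.\<close>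
  proof (cases "x < 1")
    case True
    then obtain w m where "x < w" "w \<le> 1" "affine_with_slope \<phi> m x w"
      using piecewise_linear_right[OF thompson_mapsD(3)[OF \<phi>], of x 1] x by auto
    then show ?thesis
      using x by (intro that[of x w m]) auto
  next
    case False
    then obtain w m where "0 \<le> w" "w < x" "affine_with_slope \<phi> m w x"
      using piecewise_linear_left[OF thompson_mapsD(3)[OF \<phi>], of 0 x] x by auto
    then show ?thesis
      using x by (intro that[of w x m]) auto
  qed
  obtain c where c: "\<And>y. y \<in> {a..b} \<Longrightarrow> \<phi> y = m * y + c"
    using m unfolding affine_with_slope_def by blast
  have "((\<lambda>y. m * y + c) has_field_derivative m) (at x within {a..b})"
    by (auto intro!: derivative_eq_intros)
  then have "(\<phi> has_field_derivative m) (at x within {a..b})"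
    by (rule has_field_derivative_transform_within[OF _ zero_less_one ab(4)]) (simp add: c)
  moreover have "(\<phi> has_field_derivative D) (at x within {a..b})"
    using ab by (intro has_field_derivative_subset[OF D]) auto
  ultimately have "m = D"
    using vector_derivative_unique_within_closed_interval[of a b x \<phi> m D] ab
    by (simp add: has_real_derivative_iff_has_vector_derivative)
  then show ?thesis
    using thompson_mapsD(7)[OF \<phi> ab(1-3) m] by auto
qed

text \<open>Break points of the inverse are the images of those of \<open>\<phi>\<close>, and its
  slopes are reciprocals. Differentiability passes to the inverse because the derivative of
  \<open>\<phi>\<close> never vanishes.\<close>

lemma inverse_in_thompson_maps:
  assumes \<phi>: "\<phi> \<in> thompson_maps" and ext: "\<psi> \<in> extensional {0..1}"
    and \<psi>\<phi>: "\<And>x. x \<in> {0..1} \<Longrightarrow> \<psi> (\<phi> x) = x"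
  shows "\<psi> \<in> thompson_maps"
proof -
  let ?I = "{0..1 :: real}"
  obtain \<phi>' where hom: "homeomorphism ?I ?I \<phi> \<phi>'"
    using thompson_maps_homeomorphism[OF \<phi>] .
  have surj: "\<exists>x\<in>?I. y = \<phi> x" if "y \<in> ?I" for y
    using hom that by (metis homeomorphism_def image_iff)
  have \<psi>: "\<psi> y \<in> ?I" "\<phi> (\<psi> y) = y" if "y \<in> ?I" for y
    using surj[OF that] \<psi>\<phi> by auto
  have hom': "homeomorphism ?I ?I \<psi> \<phi>"
    by (rule homeomorphism_cong[OF homeomorphism_symD[OF hom]])
      (use \<psi> hom in \<open>simp_all add: homeomorphism_def del: atLeastAtMost_iff, metis\<close>)
  have less: "\<psi> x < \<psi> y \<longleftrightarrow> x < y" if "x \<in> ?I" "y \<in> ?I" for x y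
    using thompson_maps_less_iff[OF \<phi> \<psi>(1)[OF that(1)] \<psi>(1)[OF that(2)]] \<psi>(2) that by simp
  have le: "\<psi> x \<le> \<psi> y \<longleftrightarrow> x \<le> y" if "x \<in> ?I" "y \<in> ?I" for x y
    using less that by (metis not_le)
  have "strict_mono_on ?I \<psi>"
    using less by (simp add: strict_mono_onI del: atLeastAtMost_iff)
  moreover have "piecewise_linear \<psi>"
  proof -
    obtain T where T: "finite T"
      "\<And>a b. \<lbrakk>0 \<le> a; a < b; b \<le> 1; {a<..<b} \<inter> T = {}\<rbrakk> \<Longrightarrow> \<exists>m. affine_with_slope \<phi> m a b"
      using thompson_mapsD(3)[OF \<phi>] unfolding piecewise_linear_def by blast
    have "\<exists>m. affine_with_slope \<psi> m a b"
      if ab: "0 \<le> a" "a < b" "b \<le> 1" and disj: "{a<..<b} \<inter> \<phi> ` (T \<inter> ?I) = {}" for a b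
    proof -
      have abI: "a \<in> ?I" "b \<in> ?I"
        using ab by auto
      have ab': "0 \<le> \<psi> a" "\<psi> a < \<psi> b" "\<psi> b \<le> 1"
        using \<psi>(1)[OF abI(1)] \<psi>(1)[OF abI(2)] less[OF abI] ab by auto
      moreover have "{\<psi> a<..<\<psi> b} \<inter> T = {}"
      proof (rule ccontr)
        assume "{\<psi> a<..<\<psi> b} \<inter> T \<noteq> {}"
        then obtain t where t: "t \<in> T" "\<psi> a < t" "t < \<psi> b"
          by auto
        then have tI: "t \<in> ?I"
          using ab' by auto
        then have "a < \<phi> t" "\<phi> t < b"
          using t thompson_maps_less_iff[OF \<phi>] \<psi> abI by metis+
        then show False
          using disj t tI by auto
      qed
      ultimately obtain m where m: "affine_with_slope \<phi> m (\<psi> a) (\<psi> b)"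
        using T(2) by blast
      then obtain c where c: "\<And>x. x \<in> {\<psi> a..\<psi> b} \<Longrightarrow> \<phi> x = m * x + c"
        unfolding affine_with_slope_def by blast
      have "m \<noteq> 0"
        using thompson_mapsD(7)[OF \<phi> ab' m] by auto
      have "\<psi> y = (1 / m) * y + (- c / m)" if y: "y \<in> {a..b}" for y
      proof -
        have yI: "y \<in> ?I"
          using y ab by auto
        then have "\<psi> y \<in> {\<psi> a..\<psi> b}"
          using le y abI by auto
        from c[OF this] show ?thesis
          using \<psi>(2)[OF yI] \<open>m \<noteq> 0\<close> by (simp add: field_simps)
      qed
      then show ?thesis
        unfolding affine_with_slope_def by blast
    qed
    moreover have "finite (\<phi> ` (T \<inter> ?I))"
      using T(1) by simp
    ultimately show ?thesis
      unfolding piecewise_linear_def by (intro exI[of _ "\<phi> ` (T \<inter> ?I)"]) simp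
  qed
  moreover have "\<psi> ` (dyadic_rationals \<inter> ?I) = dyadic_rationals \<inter> ?I"
  proof -
    have "\<psi> ` \<phi> ` (dyadic_rationals \<inter> ?I) = dyadic_rationals \<inter> ?I"
      unfolding image_image by (rule trans[OF image_cong[OF refl] image_ident]) (simp add: \<psi>\<phi>)
    then show ?thesis
      unfolding thompson_mapsD(4)[OF \<phi>] .
  qed
  moreover have nondiff: "nondiff_points \<psi> \<subseteq> \<phi> ` nondiff_points \<phi>"
  proof
    fix y assume "y \<in> nondiff_points \<psi>"
    then have y: "y \<in> ?I" "\<not> \<psi> differentiable (at y within ?I)"
      by (auto simp: nondiff_points_def)
    obtain x where x: "x \<in> ?I" "y = \<phi> x"
      using surj[OF y(1)] by blast
    have "\<not> \<phi> differentiable (at x within ?I)"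
    proof
      assume "\<phi> differentiable (at x within ?I)"
      then obtain D where D: "(\<phi> has_field_derivative D) (at x within ?I)"
        using real_differentiableE by blast
      have "D \<noteq> 0"
        by (rule thompson_maps_derivative_nonzero[OF \<phi> x(1) D])
      have img: "\<phi> ` ?I = ?I"
        using hom by (simp add: homeomorphism_def)
      have "(\<psi> has_derivative (*) (1 / D)) (at (\<phi> x) within \<phi> ` ?I)"
      proof (rule has_derivative_inverse_within)
        show "(\<phi> has_derivative (*) D) (at x within ?I)"
          using D by (simp add: has_field_derivative_def)
        show "continuous (at (\<phi> x) within \<phi> ` ?I) \<psi>"
          using hom' y(1) x(2) by (simp add: img homeomorphism_def continuous_on_eq_continuous_within)
        show "linear ((*) (1 / D))"
          by (rule linear_times)
      qed (use \<open>D \<noteq> 0\<close> x \<psi>\<phi> in auto)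
      then show False
        using y(2) x(2) by (auto simp: img differentiable_def)
    qed
    then show "y \<in> \<phi> ` nondiff_points \<phi>"
      using x by (auto simp: nondiff_points_def)
  qed
  moreover have "finite (nondiff_points \<psi>)"
    using nondiff thompson_mapsD(5)[OF \<phi>] by (rule finite_surj[rotated])
  moreover have "nondiff_points \<psi> \<subseteq> dyadic_rationals"
  proof -
    have "nondiff_points \<phi> \<subseteq> dyadic_rationals \<inter> ?I"
      using thompson_mapsD(6)[OF \<phi>] by (auto simp: nondiff_points_def)
    then show ?thesis
      using nondiff thompson_mapsD(4)[OF \<phi>] by blast
  qed
  moreover have "\<exists>k::int. m = 2 powi k"
    if ab: "0 \<le> a" "a < b" "b \<le> 1" and m: "affine_with_slope \<psi> m a b" for a b m
  proof -
    have abI: "a \<in> ?I" "b \<in> ?I"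
      using ab by auto
    have ab': "0 \<le> \<psi> a" "\<psi> a < \<psi> b" "\<psi> b \<le> 1"
      using \<psi>(1)[OF abI(1)] \<psi>(1)[OF abI(2)] less[OF abI] ab by auto
    \<comment> \<open>\<open>\<phi>\<close> is affine at least on a first piece starting at
      \<open>\<psi> a\<close>. Comparing the increments of \<open>\<phi>\<close> and
      \<open>\<psi>\<close> along it gives \<open>m * n = 1\<close>.\<close>
    obtain x n where x: "\<psi> a < x" "x \<le> \<psi> b" "affine_with_slope \<phi> n (\<psi> a) x"
      using piecewise_linear_right[OF thompson_mapsD(3)[OF \<phi>] ab'] .
    have xI: "x \<in> ?I"
      using x ab' by auto
    obtain k :: int where k: "n = 2 powi k"
      using thompson_mapsD(7)[OF \<phi> ab'(1) x(1) _ x(3)] xI by auto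
    have \<phi>x: "a < \<phi> x" "\<phi> x \<le> b"
      using x \<psi> abI xI thompson_maps_less_iff[OF \<phi>] thompson_maps_le_iff[OF \<phi>] by metis+
    obtain c where c: "\<And>y. y \<in> {a..b} \<Longrightarrow> \<psi> y = m * y + c"
      using m unfolding affine_with_slope_def by blast
    obtain d where d: "\<And>z. z \<in> {\<psi> a..x} \<Longrightarrow> \<phi> z = n * z + d"
      using x(3) unfolding affine_with_slope_def by blast
    have "x = m * \<phi> x + c" "\<psi> a = m * a + c"
      using c[of a] c[of "\<phi> x"] \<phi>x \<psi>\<phi> xI ab by auto
    moreover have "\<phi> x = n * x + d" "a = n * \<psi> a + d"
      using d[of x] d[of "\<psi> a"] x \<psi> abI by auto
    ultimately have "(x - \<psi> a) = m * (n * (x - \<psi> a))"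
      by (smt (verit) distrib_left right_diff_distrib)
    then have "m * n = 1"
      using x(1) by simp
    then have "m = 2 powi (- k)"
      by (simp add: k power_int_minus field_simps)
    then show ?thesis
      by blast
  qed
  ultimately show ?thesis
    unfolding thompson_maps_def using ext hom' by blast
qed

text \<open>One finite dyadic set \<open>T\<close> controls piecewise linearity, kinks and slopes
  together. Since \<open>T\<close> contains 0 and 1, a point outside \<open>T\<close> is interior
  and has an affine piece on both sides. Any affine slope agrees with that of a piece avoiding
  \<open>T\<close>.\<close>

lemma thompson_mapsI:
  assumes ext: "\<phi> \<in> extensional {0..1}" and hom: "homeomorphism {0..1} {0..1} \<phi> \<psi>"
    and mono: "strict_mono_on {0..1} \<phi>"
    and dyadic: "\<phi> ` (dyadic_rationals \<inter> {0..1}) = dyadic_rationals \<inter> {0..1}"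
    and T: "finite T" "T \<subseteq> dyadic_rationals" "0 \<in> T" "1 \<in> T"
    and affine: "\<And>a b. \<lbrakk>0 \<le> a; a < b; b \<le> 1; {a<..<b} \<inter> T = {}\<rbrakk>
      \<Longrightarrow> \<exists>k::int. affine_with_slope \<phi> (2 powi k) a b"
  shows "\<phi> \<in> thompson_maps"
proof -
  have "piecewise_linear \<phi>"
    unfolding piecewise_linear_def using affine by (intro exI[of _ T] conjI T(1)) blast
  moreover have nondiff: "nondiff_points \<phi> \<subseteq> T"
  proof (rule subsetI, rule ccontr)
    fix x assume x: "x \<in> nondiff_points \<phi>" "x \<notin> T"
    then have xI: "0 < x" "x < 1"
      using T(3,4) by (auto simp: nondiff_points_def less_le)
    obtain a where a: "0 \<le> a" "a < x" "{a<..<x} \<inter> T = {}"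
      using finite_avoid_left[OF T(1) xI(1)] .
    obtain b where b: "x < b" "b \<le> 1" "{x<..<b} \<inter> T = {}"
      using finite_avoid_right[OF T(1) xI(2)] .
    have "{a<..<b} = {a<..<x} \<union> {x} \<union> {x<..<b}"
      using a b by auto
    then have "{a<..<b} \<inter> T = {}"
      using a b x(2) by auto
    then obtain m where "affine_with_slope \<phi> m a b"
      using affine[of a b] a b by auto
    then obtain c where c: "\<And>x. x \<in> {a..b} \<Longrightarrow> \<phi> x = m * x + c"
      unfolding affine_with_slope_def by blast
    have "((\<lambda>y. m * y + c) has_field_derivative m) (at x)"
      by (auto intro!: derivative_eq_intros)
    then have "(\<phi> has_field_derivative m) (at x)"
      by (rule has_field_derivative_transform_within_open[where S = "{a<..<b}"]) (use a b c in auto)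
    then have "\<phi> differentiable (at x within {0..1})"
      using field_differentiable_imp_differentiable has_field_derivative_at_within
      by (metis field_differentiable_def)
    then show False
      using x(1) by (simp add: nondiff_points_def)
  qed
  moreover have "\<exists>k::int. m = 2 powi k"
    if ab: "0 \<le> a" "a < b" "b \<le> 1" and m: "affine_with_slope \<phi> m a b" for a b m
  proof -
    obtain w where w: "a < w" "w \<le> b" "{a<..<w} \<inter> T = {}"
      using finite_avoid_right[OF T(1) ab(2)] .
    then obtain k :: int where "affine_with_slope \<phi> (2 powi k) a w"
      using affine[of a w] ab by auto
    moreover have "affine_with_slope \<phi> m a w"
      using affine_with_slope_subset[OF m] w by simp
    ultimately show ?thesis
      using affine_with_slope_unique w(1) by blast
  qed
  ultimately show ?thesis
    unfolding thompson_maps_def using ext hom mono dyadic T(1,2) finite_subset by blast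
qed

section \<open>Arithmetic of dyadic rationals\<close>

lemma dyadic_rationalsI: "of_int m / 2 ^ n \<in> dyadic_rationals"
  unfolding dyadic_rationals_def by blast

lemma dyadic_rationals_of_int [simp]: "of_int m \<in> dyadic_rationals"
  using dyadic_rationalsI[of m 0] by simp

lemma dyadic_rationals_0 [simp]: "0 \<in> dyadic_rationals"
  and dyadic_rationals_1 [simp]: "1 \<in> dyadic_rationals"
  and dyadic_rationals_numeral [simp]: "numeral j \<in> dyadic_rationals"
  using dyadic_rationals_of_int[of 0] dyadic_rationals_of_int[of 1]
    dyadic_rationals_of_int[of "numeral j"] by simp_all

lemma dyadic_rationals_divide_power_2:
  assumes "x \<in> dyadic_rationals"
  shows "x / 2 ^ k \<in> dyadic_rationals"
proof -
  obtain m n where "x = of_int m / 2 ^ n"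
    using assms by (auto simp: dyadic_rationals_def)
  then show ?thesis
    using dyadic_rationalsI[of m "n + k"] by (simp add: power_add)
qed

lemma dyadic_rationals_half: "x \<in> dyadic_rationals \<Longrightarrow> x / 2 \<in> dyadic_rationals"
  using dyadic_rationals_divide_power_2[of x 1] by simp

lemma dyadic_rationals_add:
  assumes "x \<in> dyadic_rationals" "y \<in> dyadic_rationals"
  shows "x + y \<in> dyadic_rationals"
proof -
  obtain m n m' n' where "x = of_int m / 2 ^ n" "y = of_int m' / 2 ^ n'"
    using assms by (auto simp: dyadic_rationals_def)
  then have "x + y = of_int (m * 2 ^ n' + m' * 2 ^ n) / 2 ^ (n + n')"
    by (simp add: power_add add_divide_distrib)
  then show ?thesis
    using dyadic_rationalsI by metis
qed

lemma dyadic_rationals_mult: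
  assumes "x \<in> dyadic_rationals" "y \<in> dyadic_rationals"
  shows "x * y \<in> dyadic_rationals"
proof -
  obtain m n m' n' where "x = of_int m / 2 ^ n" "y = of_int m' / 2 ^ n'"
    using assms by (auto simp: dyadic_rationals_def)
  then have "x * y = of_int (m * m') / 2 ^ (n + n')"
    by (simp add: power_add)
  then show ?thesis
    using dyadic_rationalsI by metis
qed

lemma dyadic_rationals_diff:
  "\<lbrakk>x \<in> dyadic_rationals; y \<in> dyadic_rationals\<rbrakk> \<Longrightarrow> x - y \<in> dyadic_rationals"
  using dyadic_rationals_add[of x "- 1 * y"] dyadic_rationals_mult[of "-1" y] dyadic_rationals_of_int[of "-1"]
  by simp

lemmas dyadic_rationals_closed =
  dyadic_rationals_add dyadic_rationals_diff dyadic_rationals_mult dyadic_rationals_half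

lemma id_in_thompson_maps: "(\<lambda>x\<in>{0..1}. x) \<in> thompson_maps"
proof (rule thompson_mapsI[where T = "{0, 1}" and \<psi> = "\<lambda>x. x"])
  show "homeomorphism {0..1 :: real} {0..1} (\<lambda>x\<in>{0..1}. x) (\<lambda>x. x)"
    by (rule homeomorphism_cong[OF homeomorphism_ident]) auto
  fix a b :: real assume "0 \<le> a" "a < b" "b \<le> 1"
  then have "affine_with_slope (\<lambda>x\<in>{0..1}. x) (2 powi 0) a b"
    unfolding affine_with_slope_def by (intro exI[of _ 0]) auto
  then show "\<exists>k::int. affine_with_slope (\<lambda>x\<in>{0..1}. x) (2 powi k) a b"
    by blast
qed (auto simp: strict_mono_on_def)

lemma subgroup_thompson_maps: "subgroup thompson_maps (BijGroup {0..1})"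
proof -
  interpret B: group "BijGroup {0..1 :: real}"
    by (rule group_BijGroup)
  have Bij: "thompson_maps \<subseteq> Bij {0..1}"
    using thompson_mapsD(1) thompson_maps_bij_betw by (auto simp: Bij_def)

  show ?thesis
  proof (rule B.subgroupI)
    fix \<phi> assume \<phi>: "\<phi> \<in> thompson_maps"
    define \<psi> where "\<psi> = inv\<^bsub>BijGroup {0..1}\<^esub> \<phi>"
    have \<phi>': "\<phi> \<in> carrier (BijGroup {0..1})"
      using \<phi> Bij by (auto simp: BijGroup_def)
    have \<psi>: "\<psi> \<in> carrier (BijGroup {0..1})"
      unfolding \<psi>_def using \<phi>' by (rule B.inv_closed)
    have "\<psi> \<otimes>\<^bsub>BijGroup {0..1}\<^esub> \<phi> = \<one>\<^bsub>BijGroup {0..1}\<^esub>"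
      unfolding \<psi>_def using \<phi>' by (rule B.l_inv)
    then have *: "compose {0..1} \<psi> \<phi> = (\<lambda>x\<in>{0..1}. x)"
      using \<phi>' \<psi> by (simp add: BijGroup_def)
    have "\<psi> (\<phi> x) = x" if "x \<in> {0..1}" for x
      using fun_cong[OF *, of x] that by (simp add: compose_eq)
    then show "inv\<^bsub>BijGroup {0..1}\<^esub> \<phi> \<in> thompson_maps"
      unfolding \<psi>_def[symmetric]
      using inverse_in_thompson_maps[OF \<phi>] \<psi> by (simp add: Bij_def BijGroup_def)
  qed (use Bij id_in_thompson_maps compose_in_thompson_maps in \<open>auto simp: BijGroup_def subset_iff\<close>)
qed

text \<open>The standard generator \<open>x\<^sub>0\<close> of \<open>F\<close>, rescaled to \<open>[a, a + 4h]\<close>; it fixes every other point.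
  Being concave on this interval, it is the minimum of its three affine pieces there.\<close>

definition thompson_bump :: "real \<Rightarrow> real \<Rightarrow> real \<Rightarrow> real" where
  "thompson_bump a h =
    (\<lambda>x\<in>{0..1}. max x (min (2 * x - a) (min (x + h) (x / 2 + a / 2 + 2 * h))))"

text \<open>The inverse \<open>?g\<close> is explicit: invert each affine piece and exchange minimum
  with maximum. Dyadic points are preserved because minimum and maximum only select among dyadic
  values.\<close>

lemma thompson_bump_in_thompson_maps:
  assumes a: "a \<in> dyadic_rationals" "0 \<le> a" and h: "h \<in> dyadic_rationals" "0 < h"
    and le: "a + 4 * h \<le> 1"
  shows "thompson_bump a h \<in> thompson_maps"
proof -
  let ?f = "\<lambda>x::real. max x (min (2 * x - a) (min (x + h) (x / 2 + a / 2 + 2 * h)))"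
  let ?g = "\<lambda>z::real. min z (max (z / 2 + a / 2) (max (z - h) (2 * z - a - 4 * h)))"
  let ?T = "{0, 1, a, a + h, a + 2 * h, a + 4 * h}"
  have eq: "thompson_bump a h x = ?f x" if "x \<in> {0..1}" for x
    using that by (simp add: thompson_bump_def)
  have gf: "?g (?f x) = x" and fg: "?f (?g x) = x" for x
    using h(2) by (simp_all add: max_def min_def field_simps)
  have f: "?f x \<in> {0..1}" and g: "?g x \<in> {0..1}" if "x \<in> {0..1}" for x
    using that a h le by (auto simp: max_def min_def field_simps)
  have f_dyadic: "?f x \<in> dyadic_rationals" and g_dyadic: "?g x \<in> dyadic_rationals"
    if "x \<in> dyadic_rationals" for x
    using that a h by (auto simp: max_def min_def intro!: dyadic_rationals_closed)
  show ?thesis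
  proof (rule thompson_mapsI[where T = ?T and \<psi> = ?g])
    show "homeomorphism {0..1} {0..1} (thompson_bump a h) ?g"
    proof (rule homeomorphism_cong)
      show "homeomorphism {0..1} {0..1} ?f ?g"
        by (intro homeomorphismI continuous_intros image_subsetI f g gf fg) auto
    qed (use eq in auto)
    show "strict_mono_on {0..1} (thompson_bump a h)"
      by (intro strict_mono_onI) (simp add: eq del: atLeastAtMost_iff, simp add: max_def min_def)
    show "thompson_bump a h ` (dyadic_rationals \<inter> {0..1}) = dyadic_rationals \<inter> {0..1}"
    proof
      show "thompson_bump a h ` (dyadic_rationals \<inter> {0..1}) \<subseteq> dyadic_rationals \<inter> {0..1}"
        using f f_dyadic eq by (intro image_subsetI) (metis IntD1 IntD2 IntI)
      show "dyadic_rationals \<inter> {0..1} \<subseteq> thompson_bump a h ` (dyadic_rationals \<inter> {0..1})"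
        using g g_dyadic eq fg by (intro subsetI) (metis IntD1 IntD2 IntI imageI)
    qed
    fix u v :: real assume uv: "0 \<le> u" "u < v" "v \<le> 1" and disj: "{u<..<v} \<inter> ?T = {}"
    have avoid: "t \<le> u \<or> v \<le> t" if "t \<in> ?T" for t
      using disj that by (metis IntI empty_iff greaterThanLessThan_iff not_le)
    have affineI: "\<exists>k::int. affine_with_slope (thompson_bump a h) (2 powi k) u v"
      if "\<And>x. x \<in> {u..v} \<Longrightarrow> ?f x = 2 powi k * x + c" for k :: int and c
    proof -
      have "thompson_bump a h x = 2 powi k * x + c" if "x \<in> {u..v}" for x
        using eq[of x] uv \<open>\<And>x. x \<in> {u..v} \<Longrightarrow> ?f x = 2 powi k * x + c\<close>[OF that] that by auto
      then show ?thesis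
        unfolding affine_with_slope_def by blast
    qed
    \<comment> \<open>With no break point inside, \<open>[u, v]\<close> lies in a single piece. The
      slopes are 1 outside the bump and then 2, 1, 1/2 within it.\<close>
    consider "v \<le> a \<or> a + 4 * h \<le> u" | "a \<le> u" "v \<le> a + h"
      | "a + h \<le> u" "v \<le> a + 2 * h" | "a + 2 * h \<le> u" "v \<le> a + 4 * h"
      using avoid[of a] avoid[of "a + h"] avoid[of "a + 2 * h"] avoid[of "a + 4 * h"] by fastforce
    then show "\<exists>k::int. affine_with_slope (thompson_bump a h) (2 powi k) u v"
    proof cases
      case 1
      then show ?thesis
        using h(2) by (intro affineI[of 0 0]) (auto simp: max_def min_def)
    next
      case 2
      then show ?thesis
        using h(2) by (intro affineI[of 1 "- a"]) (auto simp: max_def min_def)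
    next
      case 3
      then show ?thesis
        using h(2) by (intro affineI[of 0 h]) (auto simp: max_def min_def)
    next
      case 4
      then show ?thesis
        using h(2) by (intro affineI[of "-1" "a / 2 + 2 * h"]) (auto simp: max_def min_def power_int_minus)
    qed
  qed (use a h in \<open>auto simp: thompson_bump_def intro!: dyadic_rationals_closed\<close>)
qed

lemma thompson_bump_ge: "x \<in> {0..1} \<Longrightarrow> x \<le> thompson_bump a h x"
  by (simp add: thompson_bump_def)

lemma thompson_bump_fixes: "\<lbrakk>p \<in> {0..1}; 0 \<le> h; p \<le> a \<or> a + 4 * h \<le> p\<rbrakk> \<Longrightarrow> thompson_bump a h p = p"
  by (auto simp: thompson_bump_def max_def min_def)

text \<open>The middle piece is the translation by \<open>h\<close>, so the wandering interval
  starting at \<open>a + h\<close> is exactly \<open>[a + h, a + 2 h)\<close>.\<close>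

lemma thompson_bump_shift:
  "\<lbrakk>0 \<le> a; 0 \<le> h; a + 4 * h \<le> 1\<rbrakk> \<Longrightarrow> thompson_bump a h (a + h) = a + 2 * h"
  by (auto simp: thompson_bump_def max_def min_def field_simps)

section \<open>Pointwise evaluation of the group operations\<close>

lemma group_thompson_F: "group thompson_F"
  unfolding thompson_F_def using subgroup_thompson_maps group_BijGroup by (rule subgroup.subgroup_is_group)

lemma carrier_thompson_F [simp]: "carrier thompson_F = thompson_maps"
  by (simp add: thompson_F_def)

lemma thompson_F_mult:
  assumes "\<phi> \<in> thompson_maps" "\<psi> \<in> thompson_maps" "x \<in> {0..1}"
  shows "(\<phi> \<otimes>\<^bsub>thompson_F\<^esub> \<psi>) x = \<phi> (\<psi> x)"
proof -
  have "\<phi> \<in> Bij {0..1}" "\<psi> \<in> Bij {0..1}"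
    using assms subgroup.subset[OF subgroup_thompson_maps] by (auto simp: BijGroup_def)
  then show ?thesis
    using assms(3) by (simp add: thompson_F_def BijGroup_def compose_eq)
qed

lemma thompson_F_one: "x \<in> {0..1} \<Longrightarrow> \<one>\<^bsub>thompson_F\<^esub> x = x"
  by (simp add: thompson_F_def BijGroup_def)

lemma thompson_F_inv:
  assumes "\<phi> \<in> thompson_maps" "x \<in> {0..1}"
  shows "(inv\<^bsub>thompson_F\<^esub> \<phi>) (\<phi> x) = x"
proof -
  interpret group thompson_F
    by (rule group_thompson_F)
  have "inv\<^bsub>thompson_F\<^esub> \<phi> \<in> thompson_maps"
    using assms(1) inv_closed[of \<phi>] by simp
  then show ?thesis
    using assms thompson_F_mult[of "inv\<^bsub>thompson_F\<^esub> \<phi>" \<phi> x] by (simp add: thompson_F_one)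
qed

section \<open>The distribution of mass under the principal representations\<close>

lemma square_integrableD:
  assumes "square_integrable M f"
  shows "f \<in> borel_measurable M" "integrable M (\<lambda>x. (cmod (f x))\<^sup>2)"
  using assms by (simp_all add: square_integrable_def)

text \<open>Dominated by \<open>|f|^2 + |g|^2\<close>.\<close>

lemma integrable_mult_cnj:
  assumes f: "square_integrable M f" and g: "square_integrable M g"
  shows "integrable M (\<lambda>x. f x * cnj (g x))"
proof (rule Bochner_Integration.integrable_bound)
  note [measurable] = square_integrableD(1)[OF f] square_integrableD(1)[OF g]
  show "integrable M (\<lambda>x. (cmod (f x))\<^sup>2 + (cmod (g x))\<^sup>2)"
    using square_integrableD(2)[OF f] square_integrableD(2)[OF g] by simp
  have [measurable]: "cnj \<in> borel_measurable borel"
    by (intro borel_measurable_continuous_onI continuous_intros)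
  show "(\<lambda>x. f x * cnj (g x)) \<in> borel_measurable M"
    by measurable
  have "a * b \<le> a\<^sup>2 + b\<^sup>2" if "0 \<le> a" "0 \<le> b" for a b :: real
    using that sum_squares_bound[of a b] mult_nonneg_nonneg[OF that] by linarith
  then show "AE x in M. norm (f x * cnj (g x)) \<le> norm ((cmod (f x))\<^sup>2 + (cmod (g x))\<^sup>2)"
    by (simp add: norm_mult)
qed

lemma L2_repr_L2_class:
  assumes "square_integrable M f"
  shows "square_integrable M (L2_repr (L2_class M f))" "AE x in M. L2_repr (L2_class M f) x = f x"
proof -
  have "f \<in> L2_class M f"
    using assms by (simp add: L2_class_def)
  then have "L2_repr (L2_class M f) \<in> L2_class M f"
    unfolding L2_repr_def by (rule someI[where P = "\<lambda>g. g \<in> L2_class M f"])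
  then show "square_integrable M (L2_repr (L2_class M f))" "AE x in M. L2_repr (L2_class M f) x = f x"
    by (simp_all add: L2_class_def)
qed

lemma L2_space_repr:
  assumes "A \<in> carrier (L2_space M)"
  shows "square_integrable M (L2_repr A)" "L2_class M (L2_repr A) = A"
proof -
  obtain f where f: "square_integrable M f" "A = L2_class M f"
    using assms by (auto simp: L2_space_def)
  show "square_integrable M (L2_repr A)"
    using L2_repr_L2_class[OF f(1)] f(2) by simp
  have eq: "AE x in M. L2_repr A x = f x"
    using L2_repr_L2_class[OF f(1)] f(2) by simp
  have "(AE x in M. g x = L2_repr A x) \<longleftrightarrow> (AE x in M. g x = f x)" for g
    using eq by (auto elim: eventually_elim2)
  then show "L2_class M (L2_repr A) = A"
    by (simp add: f(2) L2_class_def)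
qed

lemma L2_class_in_L2_space: "square_integrable M f \<Longrightarrow> L2_class M f \<in> carrier (L2_space M)"
  by (simp add: L2_space_def)

lemma cip_L2_class:
  assumes f: "square_integrable M f" and g: "square_integrable M g"
  shows "cip (L2_space M) (L2_class M f) (L2_class M g) = (\<integral>x. f x * cnj (g x) \<partial>M)"
proof -
  note f' = L2_repr_L2_class[OF f] and g' = L2_repr_L2_class[OF g]
  have "cip (L2_space M) (L2_class M f) (L2_class M g) =
      (\<integral>x. L2_repr (L2_class M f) x * cnj (L2_repr (L2_class M g) x) \<partial>M)"
    by (simp add: L2_space_def)
  also have "\<dots> = (\<integral>x. f x * cnj (g x) \<partial>M)"
    using integrable_mult_cnj[OF f'(1) g'(1)] integrable_mult_cnj[OF f g] f'(2) g'(2)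
    by (intro integral_cong_AE borel_measurable_integrable) (auto elim: eventually_elim2)
  finally show ?thesis .
qed

text \<open>Treating mass as a measure makes countable additivity available for the disjoint
  preimages of a wandering interval.\<close>

definition mass_measure :: "'a measure \<Rightarrow> ('a \<Rightarrow> complex) \<Rightarrow> 'a measure" where
  "mass_measure M f = density M (\<lambda>x. ennreal ((cmod (f x))\<^sup>2))"

lemma sets_mass_measure [simp, measurable_cong]: "sets (mass_measure M f) = sets M"
  and space_mass_measure [simp]: "space (mass_measure M f) = space M"
  by (simp_all add: mass_measure_def)

lemma emeasure_mass_measure:
  assumes "square_integrable M f" "K \<in> sets M"
  shows "emeasure (mass_measure M f) K = (\<integral>\<^sup>+x. ennreal ((cmod (f x))\<^sup>2) * indicator K x \<partial>M)"
  unfolding mass_measure_def using square_integrableD(1)[OF assms(1)] assms(2)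
  by (intro emeasure_density) auto

lemma finite_measure_mass_measure:
  assumes "square_integrable M f"
  shows "finite_measure (mass_measure M f)"
proof
  have "emeasure (mass_measure M f) (space M) = (\<integral>\<^sup>+x. ennreal ((cmod (f x))\<^sup>2) \<partial>M)"
    unfolding emeasure_mass_measure[OF assms sets.top] by (intro nn_integral_cong) simp
  then show "emeasure (mass_measure M f) (space (mass_measure M f)) \<noteq> \<infinity>"
    using square_integrableD(2)[OF assms] by (simp add: nn_integral_eq_integral)
qed

text \<open>Integrate \<open>|f|^2 \<le> 2 |g - f|^2 + 2 |g|^2\<close> over \<open>K\<close>,
  enlarging the first term to the whole space. There it is the squared distance of \<open>f\<close>
  and \<open>g\<close>, expanded into inner products so that recurrence can bound it.\<close>

lemma measure_mass_measure_le:
  assumes f: "square_integrable M f" and g: "square_integrable M g" and K[measurable]: "K \<in> sets M"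
  shows "measure (mass_measure M f) K \<le>
    2 * Re ((\<integral>x. f x * cnj (f x) \<partial>M) + (\<integral>x. g x * cnj (g x) \<partial>M) - 2 * (\<integral>x. g x * cnj (f x) \<partial>M))
    + 2 * measure (mass_measure M g) K"
proof -
  have mass: "measure (mass_measure M h) K = (\<integral>x. (cmod (h x))\<^sup>2 * indicator K x \<partial>M)"
    and int: "integrable M (\<lambda>x. (cmod (h x))\<^sup>2 * indicator K x)" if h: "square_integrable M h" for h
  proof -
    note [measurable] = square_integrableD(1)[OF h]
    show *: "integrable M (\<lambda>x. (cmod (h x))\<^sup>2 * indicator K x)"
      using square_integrableD(2)[OF h] K by (rule integrable_real_mult_indicator[rotated])
    have "emeasure (mass_measure M h) K = (\<integral>\<^sup>+x. ennreal ((cmod (h x))\<^sup>2 * indicator K x) \<partial>M)"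
      unfolding emeasure_mass_measure[OF h K]
      by (intro nn_integral_cong) (simp add: ennreal_mult' split: split_indicator)
    also have "\<dots> = ennreal (\<integral>x. (cmod (h x))\<^sup>2 * indicator K x \<partial>M)"
      using * by (intro nn_integral_eq_integral) auto
    finally show "measure (mass_measure M h) K = (\<integral>x. (cmod (h x))\<^sup>2 * indicator K x \<partial>M)"
      by (simp add: measure_def)
  qed
  \<comment> \<open>The expansion of \<open>|g - f|^2\<close>, in the form whose integral splits
    into inner products.\<close>
  define d where "d x = Re (f x * cnj (f x) + g x * cnj (g x) - 2 * (g x * cnj (f x)))" for x
  note ints = integrable_mult_cnj[OF f f] integrable_mult_cnj[OF g g] integrable_mult_cnj[OF g f]
  have d: "d x = (cmod (g x - f x))\<^sup>2" for x
    unfolding cmod_power2 d_def by (simp add: power2_eq_square algebra_simps)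
  have d_int: "integrable M (\<lambda>x. d x)"
    unfolding d_def using ints by (intro integrable_Re) simp
  have pointwise: "(cmod (f x))\<^sup>2 * indicator K x \<le> 2 * d x + 2 * ((cmod (g x))\<^sup>2 * indicator K x)" for x
  proof -
    have "cmod (f x) \<le> cmod (g x - f x) + cmod (g x)"
      using norm_triangle_ineq4[of "g x" "g x - f x"] by simp
    then have "(cmod (f x))\<^sup>2 \<le> (cmod (g x - f x) + cmod (g x))\<^sup>2"
      by (intro power_mono) auto
    also have "\<dots> \<le> 2 * (cmod (g x - f x))\<^sup>2 + 2 * (cmod (g x))\<^sup>2"
      using sum_squares_bound[of "cmod (g x - f x)" "cmod (g x)"] by (simp add: power2_sum)
    finally show ?thesis
      unfolding d by (simp split: split_indicator)
  qed
  have "(\<integral>x. (cmod (f x))\<^sup>2 * indicator K x \<partial>M)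
      \<le> (\<integral>x. 2 * d x + 2 * ((cmod (g x))\<^sup>2 * indicator K x) \<partial>M)"
    using pointwise int[OF f] int[OF g] d_int by (intro integral_mono) simp_all
  also have "\<dots> = 2 * (\<integral>x. d x \<partial>M) + 2 * (\<integral>x. (cmod (g x))\<^sup>2 * indicator K x \<partial>M)"
    using int[OF g] d_int by simp
  also have "(\<integral>x. d x \<partial>M) =
      Re (\<integral>x. f x * cnj (f x) + g x * cnj (g x) - 2 * (g x * cnj (f x)) \<partial>M)"
    unfolding d_def using ints by (intro integral_Re) simp
  also have "(\<integral>x. f x * cnj (f x) + g x * cnj (g x) - 2 * (g x * cnj (f x)) \<partial>M) =
      (\<integral>x. f x * cnj (f x) \<partial>M) + (\<integral>x. g x * cnj (g x) \<partial>M) - 2 * (\<integral>x. g x * cnj (f x) \<partial>M)"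
    using ints by simp
  finally show ?thesis
    using mass[OF f] mass[OF g] by simp
qed

section \<open>Transport of mass on the unit interval\<close>

lemma space_unit_lebesgue [simp]: "space unit_lebesgue = {0..1}"
  by (simp add: unit_lebesgue_def space_restrict_space)

lemma sets_unit_lebesgue: "sets unit_lebesgue = sets (restrict_space borel {0..1})"
  unfolding unit_lebesgue_def by (intro sets_restrict_space_cong) simp

lemma thompson_maps_measurable:
  assumes "\<phi> \<in> thompson_maps"
  shows "\<phi> \<in> measurable unit_lebesgue unit_lebesgue"
proof -
  obtain \<psi> where "homeomorphism {0..1} {0..1} \<phi> \<psi>"
    using thompson_maps_homeomorphism[OF assms] .
  then have "\<phi> \<in> borel_measurable (restrict_space borel {0..1})"
    by (intro borel_measurable_continuous_on_restrict) (simp add: homeomorphism_def)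
  then have "\<phi> \<in> borel_measurable unit_lebesgue"
    by (simp cong: measurable_cong_sets add: sets_unit_lebesgue)
  then have "\<phi> \<in> measurable unit_lebesgue (restrict_space borel {0..1})"
    using thompson_maps_in_unit[OF assms] by (intro measurable_restrict_space2) (auto simp: Pi_iff)
  then show ?thesis
    by (simp cong: measurable_cong_sets add: sets_unit_lebesgue)
qed

text \<open>The formula of \<open>principal_rep\<close> on functions in place of classes, so that
  pointwise estimates make sense.\<close>

definition principal_fun :: "real \<Rightarrow> (real \<Rightarrow> real) \<Rightarrow> (real \<Rightarrow> complex) \<Rightarrow> real \<Rightarrow> complex" where
  "principal_fun s \<gamma> f x =
    complex_of_real (enn2real (RN_deriv unit_lebesgue (distr unit_lebesgue unit_lebesgue \<gamma>) x))
      powr (1 / 2 + \<i> * complex_of_real s) * f ((inv\<^bsub>thompson_F\<^esub> \<gamma>) x)"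

lemma principal_rep_eq: "principal_rep s \<gamma> A = L2_class unit_lebesgue (principal_fun s \<gamma> (L2_repr A))"
  by (simp add: principal_rep_def principal_fun_def[abs_def])

context
  fixes \<gamma> :: "real \<Rightarrow> real" and f :: "real \<Rightarrow> complex" and s :: real
  assumes \<gamma>: "\<gamma> \<in> thompson_maps" and f: "square_integrable unit_lebesgue f"
begin

lemma principal_fun_measurable: "principal_fun s \<gamma> f \<in> borel_measurable unit_lebesgue"
proof -
  let ?r = "\<lambda>x. enn2real (RN_deriv unit_lebesgue (distr unit_lebesgue unit_lebesgue \<gamma>) x)"
  let ?z = "1 / 2 + \<i> * complex_of_real s"
  note [measurable] = square_integrableD(1)[OF f]
  have "inv\<^bsub>thompson_F\<^esub> \<gamma> \<in> thompson_maps"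
    using group.inv_closed[OF group_thompson_F] \<gamma> by simp
  note [measurable] = thompson_maps_measurable[OF this]
  \<comment> \<open>Complex \<open>powr\<close> at a nonnegative real base unfolds into
    \<open>exp\<close> and real \<open>ln\<close>, with value 0 at 0; this form is visibly
    measurable.\<close>
  have powr: "complex_of_real r powr ?z = (if r = 0 then 0 else exp (?z * complex_of_real (ln r)))"
    if "0 \<le> r" for r
    using that by (auto simp: powr_def Ln_of_real)
  have "principal_fun s \<gamma> f =
      (\<lambda>x. (if ?r x = 0 then 0 else exp (?z * complex_of_real (ln (?r x)))) * f ((inv\<^bsub>thompson_F\<^esub> \<gamma>) x))"
    unfolding principal_fun_def[abs_def] powr[OF enn2real_nonneg] ..
  also have "\<dots> \<in> borel_measurable unit_lebesgue"
    by measurable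
  finally show ?thesis .
qed

text \<open>The modulus of \<open>r powr (1/2 + i s)\<close> is \<open>sqrt r\<close>, so
  \<open>s\<close> disappears and the squared modulus carries exactly the density of the
  push-forward. Changing variables by \<open>\<gamma>\<close> pulls \<open>K\<close> back.\<close>

lemma nn_integral_principal_fun_le:
  assumes K[measurable]: "K \<in> sets unit_lebesgue"
  shows "(\<integral>\<^sup>+x. ennreal ((cmod (principal_fun s \<gamma> f x))\<^sup>2) * indicator K x \<partial>unit_lebesgue)
    \<le> emeasure (mass_measure unit_lebesgue f) (\<gamma> -` K \<inter> {0..1})"
proof -
  let ?M = unit_lebesgue
  let ?N = "distr ?M ?M \<gamma>"
  let ?R = "RN_deriv ?M ?N"
  let ?i = "inv\<^bsub>thompson_F\<^esub> \<gamma>"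
  let ?u = "\<lambda>x. ennreal ((cmod (f (?i x)))\<^sup>2) * indicator K x"
  note [measurable] = square_integrableD(1)[OF f] thompson_maps_measurable[OF \<gamma>]
  have "?i \<in> thompson_maps"
    using group.inv_closed[OF group_thompson_F] \<gamma> by simp
  note [measurable] = thompson_maps_measurable[OF this]
  have cmod_eq: "(cmod (principal_fun s \<gamma> f x))\<^sup>2 = enn2real (?R x) * (cmod (f (?i x)))\<^sup>2" for x
    by (simp add: principal_fun_def norm_mult norm_powr_real_powr power_mult_distrib powr_half_sqrt)
  have "(\<integral>\<^sup>+x. ennreal ((cmod (principal_fun s \<gamma> f x))\<^sup>2) * indicator K x \<partial>?M)
      \<le> (\<integral>\<^sup>+x. ?R x * ?u x \<partial>?M)"
    \<comment> \<open>An inequality, because \<open>enn2real\<close> sends an infinite density to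
      0.\<close>
    unfolding cmod_eq
    by (intro nn_integral_mono)
      (auto simp: ennreal_mult mult.assoc ennreal_enn2real_if intro!: mult_right_mono)
  also have "\<dots> \<le> (\<integral>\<^sup>+x. ?u x \<partial>?N)"
  proof (cases "\<exists>h. h \<in> borel_measurable ?M \<and> density ?M h = ?N")
    case True
    then have "density ?M ?R = ?N"
      using RN_derivI by blast
    then have "(\<integral>\<^sup>+x. ?u x \<partial>?N) = (\<integral>\<^sup>+x. ?u x \<partial>density ?M ?R)"
      by simp
    also have "\<dots> = (\<integral>\<^sup>+x. ?R x * ?u x \<partial>?M)"
      by (intro nn_integral_density) measurable
    finally show ?thesis
      by simp
  next
    case False
    \<comment> \<open>\<^const>\<open>RN_deriv\<close> is \<open>0\<close> when there is no density, so absolute continuity of the push-forward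
      need not be established.\<close>
    then have "?R = (\<lambda>_. 0)"
      unfolding RN_deriv_def by (rule if_not_P)
    then show ?thesis
      by simp
  qed
  also have "\<dots> = (\<integral>\<^sup>+x. ?u (\<gamma> x) \<partial>?M)"
    by (intro nn_integral_distr) measurable
  also have "\<dots> = (\<integral>\<^sup>+x. ennreal ((cmod (f x))\<^sup>2) * indicator (\<gamma> -` K \<inter> {0..1}) x \<partial>?M)"
    by (intro nn_integral_cong) (simp add: thompson_F_inv[OF \<gamma>] indicator_def)
  also have "\<dots> = emeasure (mass_measure ?M f) (\<gamma> -` K \<inter> {0..1})"
  proof (rule emeasure_mass_measure[OF f, symmetric])
    have "\<gamma> -` K \<inter> space ?M \<in> sets ?M"
      by measurable
    then show "\<gamma> -` K \<inter> {0..1} \<in> sets ?M"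
      by simp
  qed
  finally show ?thesis .
qed

lemma principal_fun_square_integrable: "square_integrable unit_lebesgue (principal_fun s \<gamma> f)"
proof -
  interpret finite_measure "mass_measure unit_lebesgue f"
    by (rule finite_measure_mass_measure[OF f])
  note [measurable] = principal_fun_measurable
  have "(\<integral>\<^sup>+x. ennreal ((cmod (principal_fun s \<gamma> f x))\<^sup>2) \<partial>unit_lebesgue) =
      (\<integral>\<^sup>+x. ennreal ((cmod (principal_fun s \<gamma> f x))\<^sup>2) * indicator {0..1} x \<partial>unit_lebesgue)"
    by (intro nn_integral_cong) simp
  also have "\<dots> \<le> emeasure (mass_measure unit_lebesgue f) (\<gamma> -` {0..1} \<inter> {0..1})"
    using sets.top[of unit_lebesgue] by (intro nn_integral_principal_fun_le) simp
  also have "\<dots> < \<infinity>"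
    by (simp flip: less_top)
  finally show ?thesis
    by (simp add: square_integrable_def principal_fun_measurable integrable_iff_bounded)
qed

lemma mass_principal_fun_le:
  assumes K: "K \<in> sets unit_lebesgue"
  shows "measure (mass_measure unit_lebesgue (principal_fun s \<gamma> f)) K
    \<le> measure (mass_measure unit_lebesgue f) (\<gamma> -` K \<inter> {0..1})"
proof -
  interpret finite_measure "mass_measure unit_lebesgue f"
    by (rule finite_measure_mass_measure[OF f])
  show ?thesis
    unfolding measure_def
    using nn_integral_principal_fun_le[OF K] emeasure_mass_measure[OF principal_fun_square_integrable K]
    by (intro enn2real_mono) (simp_all flip: less_top)
qed

end

section \<open>Iteration and wandering intervals\<close>

lemma thompson_F_pow_closed: "\<gamma> \<in> thompson_maps \<Longrightarrow> \<gamma> [^]\<^bsub>thompson_F\<^esub> (n :: nat) \<in> thompson_maps"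
  using monoid.nat_pow_closed[OF group.is_monoid[OF group_thompson_F], of \<gamma> n] by simp

text \<open>The new factor is put on the outside, so that a power is the forward orbit of
  \<open>x\<close>.\<close>

lemma thompson_F_pow_Suc:
  "\<lbrakk>\<gamma> \<in> thompson_maps; x \<in> {0..1}\<rbrakk>
    \<Longrightarrow> (\<gamma> [^]\<^bsub>thompson_F\<^esub> Suc n) x = \<gamma> ((\<gamma> [^]\<^bsub>thompson_F\<^esub> n) x)"
  using monoid.nat_pow_Suc2[OF group.is_monoid[OF group_thompson_F], of \<gamma> n]
  by (simp add: thompson_F_mult thompson_F_pow_closed)

lemma interval_in_sets_unit_lebesgue:
  "\<lbrakk>0 \<le> a; b \<le> 1\<rbrakk> \<Longrightarrow> {a..<b} \<in> sets unit_lebesgue"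
  unfolding sets_unit_lebesgue by (subst sets_restrict_space_iff) auto

text \<open>Once an orbit reaches \<open>c\<close> or beyond, its next point is at least
  \<open>\<gamma> c\<close>, and it never moves left again. So the preimages of
  \<open>[c, \<gamma> c)\<close> under distinct powers are disjoint, and their masses form a
  convergent series.\<close>

lemma mass_preimage_pow_tendsto_0:
  assumes \<gamma>: "\<gamma> \<in> thompson_maps" and ge: "\<And>x. x \<in> {0..1} \<Longrightarrow> x \<le> \<gamma> x"
    and f: "square_integrable unit_lebesgue f" and c: "c \<in> {0..1}"
  shows "(\<lambda>n. measure (mass_measure unit_lebesgue f)
      ((\<gamma> [^]\<^bsub>thompson_F\<^esub> n) -` {c..<\<gamma> c} \<inter> {0..1})) \<longlonglongrightarrow> 0"
proof -
  interpret finite_measure "mass_measure unit_lebesgue f"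
    by (rule finite_measure_mass_measure[OF f])
  let ?g = "\<lambda>n::nat. \<gamma> [^]\<^bsub>thompson_F\<^esub> n"
  define P where "P n = ?g n -` {c..<\<gamma> c} \<inter> {0..1}" for n
  have unit: "?g n x \<in> {0..1}" if "x \<in> {0..1}" for n x
    using thompson_maps_in_unit[OF thompson_F_pow_closed[OF \<gamma>] that] .
  have later: "\<gamma> (?g m x) \<le> ?g (Suc m + k) x" if x: "x \<in> {0..1}" for m k x
  proof (induction k)
    case 0
    then show ?case
      using thompson_F_pow_Suc[OF \<gamma> x, of m] by simp
  next
    case (Suc k)
    then show ?case
      using thompson_F_pow_Suc[OF \<gamma> x, of "Suc m + k"] ge[OF unit[OF x, of "Suc m + k"]] by simp
  qed
  have "P m \<inter> P n = {}" if "m < n" for m n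
  proof (rule ccontr)
    assume "P m \<inter> P n \<noteq> {}"
    then obtain x where x: "x \<in> {0..1}" "c \<le> ?g m x" "?g n x < \<gamma> c"
      by (auto simp: P_def simp del: atLeastAtMost_iff)
    have "\<gamma> c \<le> \<gamma> (?g m x)"
      using thompson_maps_le_iff[OF \<gamma> c unit[OF x(1)]] x(2) by simp
    also have "\<dots> \<le> ?g n x"
      using later[OF x(1), of m "n - Suc m"] that by simp
    finally show False
      using x(3) by simp
  qed
  then have "disjoint_family P"
    unfolding disjoint_family_on_def by (metis Int_commute linorder_neqE_nat)
  moreover have "P n \<in> sets unit_lebesgue" for n
  proof -
    have "{c..<\<gamma> c} \<in> sets unit_lebesgue"
      using c thompson_maps_in_unit[OF \<gamma> c] by (intro interval_in_sets_unit_lebesgue) auto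
    then have "?g n -` {c..<\<gamma> c} \<inter> space unit_lebesgue \<in> sets unit_lebesgue"
      by (rule measurable_sets[OF thompson_maps_measurable[OF thompson_F_pow_closed[OF \<gamma>]]])
    then show ?thesis
      by (simp add: P_def)
  qed
  ultimately have "(\<lambda>n. measure (mass_measure unit_lebesgue f) (P n)) sums
      measure (mass_measure unit_lebesgue f) (\<Union>n. P n)"
    by (intro finite_measure_UNION) auto
  then show ?thesis
    unfolding P_def by (intro summable_LIMSEQ_zero) (rule sums_summable)
qed

text \<open>The mass on \<open>[c, \<gamma> c)\<close> is compared with that of a late translate:
  recurrence makes the translate close to \<open>A\<close> in norm, while wandering leaves it almost
  no mass on the interval.\<close>

lemma AE_zero_on_fundamental_domain:
  assumes \<gamma>: "\<gamma> \<in> thompson_maps" and ge: "\<And>x. x \<in> {0..1} \<Longrightarrow> x \<le> \<gamma> x"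
    and c: "c \<in> {0..1}"
    and A: "A \<in> carrier (L2_space unit_lebesgue)"
    and norm: "\<And>n::nat. cip (L2_space unit_lebesgue)
        (principal_rep s (\<gamma> [^]\<^bsub>thompson_F\<^esub> n) A) (principal_rep s (\<gamma> [^]\<^bsub>thompson_F\<^esub> n) A)
      = cip (L2_space unit_lebesgue) A A"
    and recurrent: "\<And>\<epsilon> m. \<epsilon> > 0 \<Longrightarrow> \<exists>n\<ge>m.
      Re (cip (L2_space unit_lebesgue) (principal_rep s (\<gamma> [^]\<^bsub>thompson_F\<^esub> (n::nat)) A) A)
        > Re (cip (L2_space unit_lebesgue) A A) - \<epsilon>"
  shows "AE x in unit_lebesgue. x \<in> {c..<\<gamma> c} \<longrightarrow> L2_repr A x = 0"
proof -
  let ?M = unit_lebesgue and ?F = "L2_repr A" and ?K = "{c..<\<gamma> c}"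
  let ?g = "\<lambda>n::nat. \<gamma> [^]\<^bsub>thompson_F\<^esub> n"
  let ?G = "\<lambda>n. principal_fun s (?g n) ?F"
  have F: "square_integrable ?M ?F" "L2_class ?M ?F = A"
    by (rule L2_space_repr[OF A])+
  interpret finite_measure "mass_measure ?M ?F"
    by (rule finite_measure_mass_measure[OF F(1)])
  have G: "square_integrable ?M (?G n)" for n
    using principal_fun_square_integrable[OF thompson_F_pow_closed[OF \<gamma>] F(1)] .
  have K: "?K \<in> sets ?M"
    using c thompson_maps_in_unit[OF \<gamma> c] by (intro interval_in_sets_unit_lebesgue) auto
  define a where "a = cip (L2_space ?M) A A"
  have FF: "(\<integral>x. ?F x * cnj (?F x) \<partial>?M) = a"
    using cip_L2_class[OF F(1) F(1)] by (simp add: F(2) a_def)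
  have GG: "(\<integral>x. ?G n x * cnj (?G n x) \<partial>?M) = a" for n
    using cip_L2_class[OF G G] norm[of n] by (simp add: principal_rep_eq a_def)
  have GF: "(\<integral>x. ?G n x * cnj (?F x) \<partial>?M) = cip (L2_space ?M) (principal_rep s (?g n) A) A" for n
    using cip_L2_class[OF G F(1)] by (simp add: principal_rep_eq F(2))
  have "measure (mass_measure ?M ?F) ?K \<le> 0 + \<epsilon>" if "\<epsilon> > 0" for \<epsilon>
  proof -
    \<comment> \<open>Recurrence enters the final bound with factor 4 and the mass of the preimage
      with factor 2.\<close>
    have "0 < \<epsilon> / 6"
      using that by simp
    then have "eventually (\<lambda>n. measure (mass_measure ?M ?F) (?g n -` ?K \<inter> {0..1}) < \<epsilon> / 6) sequentially"
      using mass_preimage_pow_tendsto_0[OF \<gamma> _ F(1) c, OF ge] by (intro order_tendstoD(2)) auto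
    then obtain N where N: "\<And>n. n \<ge> N \<Longrightarrow> measure (mass_measure ?M ?F) (?g n -` ?K \<inter> {0..1}) < \<epsilon> / 6"
      unfolding eventually_sequentially by blast
    obtain n where n: "n \<ge> N" "Re (cip (L2_space ?M) (principal_rep s (?g n) A) A) > Re a - \<epsilon> / 6"
      using recurrent[OF \<open>0 < \<epsilon> / 6\<close>, of N] unfolding a_def by blast
    have "measure (mass_measure ?M ?F) ?K \<le>
        2 * Re (a + a - 2 * cip (L2_space ?M) (principal_rep s (?g n) A) A)
        + 2 * measure (mass_measure ?M (?G n)) ?K"
      using measure_mass_measure_le[OF F(1) G K, of n] by (simp only: FF GG GF)
    moreover have "measure (mass_measure ?M (?G n)) ?K \<le> measure (mass_measure ?M ?F) (?g n -` ?K \<inter> {0..1})"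
      by (rule mass_principal_fun_le[OF thompson_F_pow_closed[OF \<gamma>] F(1) K])
    ultimately show ?thesis
      using n(2) N[OF n(1)] by simp
  qed
  then have "measure (mass_measure ?M ?F) ?K \<le> 0"
    by (rule field_le_epsilon)
  then have "emeasure (mass_measure ?M ?F) ?K = 0"
    by (simp add: emeasure_eq_measure measure_le_0_iff)
  then have "(\<integral>\<^sup>+x. ennreal ((cmod (?F x))\<^sup>2) * indicator ?K x \<partial>?M) = 0"
    using emeasure_mass_measure[OF F(1) K] by simp
  then have "AE x in ?M. ennreal ((cmod (?F x))\<^sup>2) * indicator ?K x = 0"
    using square_integrableD(1)[OF F(1)] K by (subst (asm) nn_integral_0_iff_AE) auto
  then show ?thesis
    by (rule AE_mp) (auto simp: indicator_def)
qed

text \<open>Choose a mesh \<open>h\<close> with \<open>4 h\<close> below the distance from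
  \<open>x\<close> to 0, 1 and \<open>p\<close>. Four consecutive cells around \<open>x\<close> then
  stay inside the unit interval and away from \<open>p\<close>.\<close>

lemma dyadic_interval_cover:
  fixes x p :: real
  assumes "0 < x" "x < 1" "x \<noteq> p"
  obtains m :: int and n :: nat where
    "0 \<le> m / 2 ^ n" "m / 2 ^ n + 4 * (1 / 2 ^ n) \<le> 1"
    "p \<le> m / 2 ^ n \<or> m / 2 ^ n + 4 * (1 / 2 ^ n) \<le> p"
    "m / 2 ^ n + 1 / 2 ^ n \<le> x" "x < m / 2 ^ n + 2 * (1 / 2 ^ n)"
proof -
  define d where "d = Min {x, 1 - x, \<bar>x - p\<bar>}"
  have d: "d > 0" "d \<le> x" "d \<le> 1 - x" "d \<le> \<bar>x - p\<bar>"
    using assms by (auto simp: d_def)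
  obtain n where n: "(1 / 2) ^ n < d / 4"
    using real_arch_pow_inv[of "d / 4" "1 / 2"] d(1) by auto
  define h :: real where "h = 1 / 2 ^ n"
  have h: "0 < h" "4 * h < d"
    using n by (simp_all add: h_def power_divide)
  \<comment> \<open>The shift by 1 puts \<open>x\<close> in the second of the four cells starting at
    \<open>m / 2 ^ n\<close>, which is the wandering interval of the bump.\<close>
  define m where "m = \<lfloor>x * 2 ^ n\<rfloor> - 1"
  have "of_int m + 1 \<le> x * 2 ^ n" "x * 2 ^ n < of_int m + 2"
    unfolding m_def by linarith+
  then have "of_int m / 2 ^ n + h \<le> x" "x < of_int m / 2 ^ n + 2 * h"
    by (simp_all add: h_def field_simps)
  then show ?thesis
    using d h by (intro that[of m n, folded h_def]) auto
qed

section \<open>Contradiction from a unitary equivalence\<close>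

theorem proposition10:
  fixes p s :: real
    and V :: "'v complex_ip_space"
    and \<sigma> :: "(real \<Rightarrow> real) \<Rightarrow> 'v \<Rightarrow> 'v"
  assumes "p \<in> {0<..<1}"
    and "unitary_rep (thompson_F\<lparr>carrier := thompson_stabilizer p\<rparr>) V \<sigma>"
    and "finite_dimensional V"
  shows "\<not> unitarily_equivalent thompson_F
            (ind_space thompson_F (thompson_stabilizer p) V \<sigma>) (ind_rep thompson_F)
            (L2_space unit_lebesgue) (principal_rep s)"
proof
  let ?G = thompson_F and ?H = "thompson_stabilizer p" and ?M = unit_lebesgue
  let ?I = "ind_space ?G ?H V \<sigma>" and ?L = "L2_space unit_lebesgue"
  assume "unitarily_equivalent ?G ?I (ind_rep ?G) ?L (principal_rep s)"
  then obtain U where bij: "bij_betw U (carrier ?I) (carrier ?L)"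
    and U_cip: "\<And>f g. \<lbrakk>f \<in> carrier ?I; g \<in> carrier ?I\<rbrakk> \<Longrightarrow> cip ?L (U f) (U g) = cip ?I f g"
    and U_rep: "\<And>\<gamma> f. \<lbrakk>\<gamma> \<in> thompson_maps; f \<in> carrier ?I\<rbrakk> \<Longrightarrow> U (ind_rep ?G \<gamma> f) = principal_rep s \<gamma> (U f)"
    unfolding unitarily_equivalent_def unitary_map_def by auto
  interpret G: group ?G
    by (rule group_thompson_F)
  interpret \<sigma>: unitary_rep "?G\<lparr>carrier := ?H\<rparr>" V \<sigma>
    by fact
  have H: "subgroup ?H ?G"
    using unitary_rep.axioms(1)[OF assms(2)]
    by (intro G.group_incl_imp_subgroup) (auto simp: thompson_stabilizer_def)
  obtain v where v: "v \<in> carrier V" "v \<noteq> \<zero>\<^bsub>V\<^esub>"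
  proof -
    \<comment> \<open>If \<open>V\<close> were zero, so would be the induced space; but the constant
      function 1 has norm 1, so its preimage under \<open>U\<close> takes a nonzero value at some
      coset representative.\<close>
    have space: "emeasure ?M (space ?M) = 1"
      by (simp add: unit_lebesgue_def emeasure_restrict_space)
    then have "measure ?M (space ?M) = 1"
      by (simp add: measure_def)
    have "finite_measure ?M"
      using space by (intro finite_measureI) simp
    then have one: "square_integrable ?M (\<lambda>_. 1)"
      by (simp add: square_integrable_def finite_measure.integrable_const)
    then have "L2_class ?M (\<lambda>_. 1) \<in> U ` carrier ?I"
      unfolding bij_betw_imp_surj_on[OF bij] by (rule L2_class_in_L2_space)
    then obtain w where U_w: "L2_class ?M (\<lambda>_. 1) = U w" and w: "w \<in> carrier ?I"
      by (rule imageE)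
    have "cip ?I w w = 1"
      using U_cip[OF w w] cip_L2_class[OF one one] \<open>measure ?M (space ?M) = 1\<close>
      by (simp add: U_w)
    have "\<exists>C \<in> lcosets\<^bsub>?G\<^esub> ?H. w (coset_rep C) \<noteq> \<zero>\<^bsub>V\<^esub>"
    proof (rule ccontr)
      assume "\<not> ?thesis"
      then have "cip ?I w w = 0"
        by (simp add: ind_space_def infsum_0)
      then show False
        using \<open>cip ?I w w = 1\<close> by simp
    qed
    then obtain C where C: "C \<in> lcosets\<^bsub>?G\<^esub> ?H" "w (coset_rep C) \<noteq> \<zero>\<^bsub>V\<^esub>"
      by blast
    then have "w (coset_rep C) \<in> carrier V"
      using w G.coset_rep_in_carrier[OF H C(1)] by (auto simp: ind_space_def ind_carrier_def)
    then show ?thesis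
      using that C(2) by blast
  qed
  define f where "f = ind_embed ?G ?H V \<sigma>"
  define A where "A = U (f v)"
  have f_closed: "f u \<in> carrier ?I" if "u \<in> carrier V" for u
    unfolding f_def by (rule ind_embed_closed[OF group_thompson_F H assms(2) that])
  have f_cip: "cip ?I (f u) (f u') = cip V u u'" if "u \<in> carrier V" "u' \<in> carrier V" for u u'
    unfolding f_def by (rule cip_ind_embed[OF group_thompson_F H assms(2) that])
  have A: "A \<in> carrier ?L"
    unfolding A_def using bij f_closed[OF v(1)] by (rule bij_betwE[THEN bspec])
  \<comment> \<open>On the stabilizer, the principal representation moves \<open>A\<close> as
    \<open>\<sigma>\<close> moves \<open>v\<close>; norms and recurrence for \<open>A\<close> can
    therefore be computed in \<open>V\<close>.\<close>
  have rep: "principal_rep s h A = U (f (\<sigma> h v))" if "h \<in> ?H" for h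
    using ind_rep_ind_embed[OF group_thompson_F H assms(2) v(1) that] U_rep[OF _ f_closed[OF v(1)], of h] that
    by (simp add: A_def f_def thompson_stabilizer_def)
  have AA: "cip ?L A A = cip V v v"
    by (simp add: A_def U_cip f_closed f_cip v(1))
  \<comment> \<open>The bump moves only points strictly between \<open>a\<close> and
    \<open>a + 4 h\<close>, hence fixes \<open>p\<close>, and its powers lie in the
    stabilizer.\<close>
  have vanish: "AE x in ?M. x \<in> {a + h..<a + 2 * h} \<longrightarrow> L2_repr A x = 0"
    if a: "a \<in> dyadic_rationals" "0 \<le> a" and h: "h \<in> dyadic_rationals" "0 < h"
      and le: "a + 4 * h \<le> 1" and p: "p \<le> a \<or> a + 4 * h \<le> p" for a h
  proof -
    let ?b = "thompson_bump a h"
    let ?c = "\<lambda>n::nat. ?b [^]\<^bsub>?G\<^esub> n"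
    have b: "?b \<in> thompson_maps"
      by (rule thompson_bump_in_thompson_maps[OF a h le])
    then have bH: "?b \<in> ?H"
      using thompson_bump_fixes[of p h a] p h(2) assms(1) by (simp add: thompson_stabilizer_def)
    have pow_H: "?c n \<in> ?H" for n
      using \<sigma>.G.nat_pow_closed[of ?b n] bH by (simp flip: G.nat_pow_consistent)
    have \<sigma>c: "\<sigma> (?c n) v \<in> carrier V" for n
      using \<sigma>.rep_closed[of "?c n" v] pow_H v(1) by simp
    have "AE x in ?M. x \<in> {a + h..<?b (a + h)} \<longrightarrow> L2_repr A x = 0"
    proof (rule AE_zero_on_fundamental_domain[OF b thompson_bump_ge _ A])
      show "a + h \<in> {0..1}"
        using a(2) h(2) le by simp
      show "cip ?L (principal_rep s (?c n) A) (principal_rep s (?c n) A) = cip ?L A A" for n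
        using \<sigma>.cip_rep[of "?c n" v v] pow_H v(1)
        by (simp add: rep U_cip f_closed f_cip \<sigma>c AA)
      show "\<exists>n\<ge>m. Re (cip ?L A A) - \<epsilon> < Re (cip ?L (principal_rep s (?c n) A) A)"
        if "\<epsilon> > 0" for \<epsilon> m
      proof -
        have "cip ?L (principal_rep s (?c n) A) A = cip V (\<sigma> (?c n) v) v" for n
          by (subst rep[OF pow_H]) (simp add: A_def U_cip f_closed f_cip \<sigma>c v(1))
        then show ?thesis
          using \<sigma>.recurrence[OF assms(3) _ v(1) that, of ?b m] bH
          by (simp add: AA flip: G.nat_pow_consistent)
      qed
    qed simp
    then show ?thesis
      using a(2) h(2) le by (simp add: thompson_bump_shift)
  qed
  \<comment> \<open>Only countably many pairs \<open>m\<close>, \<open>n\<close> occur, so their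
    exceptional null sets can be united.\<close>
  have "AE x in ?M. \<forall>(m::int) (n::nat).
      0 \<le> m / 2 ^ n \<and> m / 2 ^ n + 4 * (1 / 2 ^ n) \<le> 1 \<and>
      (p \<le> m / 2 ^ n \<or> m / 2 ^ n + 4 * (1 / 2 ^ n) \<le> p) \<longrightarrow>
      x \<in> {m / 2 ^ n + 1 / 2 ^ n..<m / 2 ^ n + 2 * (1 / 2 ^ n)} \<longrightarrow> L2_repr A x = 0"
  proof (unfold AE_all_countable, intro allI)
    fix m :: int and n :: nat
    show "AE x in ?M. 0 \<le> m / 2 ^ n \<and> m / 2 ^ n + 4 * (1 / 2 ^ n) \<le> 1 \<and>
      (p \<le> m / 2 ^ n \<or> m / 2 ^ n + 4 * (1 / 2 ^ n) \<le> p) \<longrightarrow>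
      x \<in> {m / 2 ^ n + 1 / 2 ^ n..<m / 2 ^ n + 2 * (1 / 2 ^ n)} \<longrightarrow> L2_repr A x = 0"
      (is "AE x in ?M. ?cond \<longrightarrow> ?zero x")
    proof (cases ?cond)
      case True
      then have "AE x in ?M. ?zero x"
        by (intro vanish dyadic_rationalsI dyadic_rationals_divide_power_2) auto
      then show ?thesis
        by (rule AE_mp) simp
    next
      case False
      then show ?thesis
        by (intro AE_I2 impI) (rule notE)
    qed
  qed
  \<comment> \<open>The cover misses only 0, 1 and \<open>p\<close>, which form a null set.\<close>
  moreover have "AE x in ?M. x \<in> {0<..<1} - {p}"
  proof -
    have "AE x in lborel. x \<in> {0..1} \<longrightarrow> x \<in> {0<..<1} - {p}"
      using AE_lborel_singleton[of 0] AE_lborel_singleton[of 1] AE_lborel_singleton[of p]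
      by eventually_elim auto
    then show ?thesis
      unfolding unit_lebesgue_def by (subst AE_restrict_space_iff) simp_all
  qed
  ultimately have zero: "AE x in ?M. L2_repr A x = 0"
  proof eventually_elim
    case (elim x)
    then show ?case
      by (elim DiffE) (metis atLeastLessThan_iff dyadic_interval_cover greaterThanLessThan_iff singletonI)
  qed
  \<comment> \<open>\<open>A\<close> has norm zero, whereas by unitarity its norm is that of the
    nonzero vector \<open>v\<close>.\<close>
  have "cip ?L A A = (\<integral>x. L2_repr A x * cnj (L2_repr A x) \<partial>?M)"
    by (simp add: L2_space_def)
  also have "\<dots> = 0"
    using zero by (intro integral_eq_zero_AE) (auto elim: eventually_mono)
  finally show False
    using \<sigma>.cip_pos[OF v] AA by simp
qed

end
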